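(* Let $(X,\rho,\mu)$ be a space of homogeneous type, let $w\in A_\infty$, let $D=1/\varepsilon$ where $\varepsilon$ is the child/parent constant of the dyadic decompositions of $X$, and let $$0<r\le\frac{1}{2D\,[w]_{A_\infty}-1}.$$ Then for every cube $Q\subset X$, $$\frac1{\mu(Q)}\int_Q w^{1+r}\,d\mu\le 2\left(\frac1{\mu(Q)}\int_Q w\,d\mu\right)^{1+r}.$$
   Context: Space of homogeneous type: a triple $(X,\rho,\mu)$ where $\rho$ is a quasimetric ($\rho(x,y)=0$ iff $x=y$; symmetric; $\rho(x,z)\le\kappa(\rho(x,y)+\rho(y,z))$) and $\mu$ is a positive doubling measure: $0<\mu(B(x_0,2r))\le D_\mu\,\mu(B(x_0,r))<\infty$. The Lebesgue differentiation theorem holds in this setting. Dyadic cubes: a dyadic decomposition of $X$ is a family $\mathcal D=\bigcup_{k\in\mathbb Z}\mathcal D_k$ of sets with points $x_c(Q)$, $Q\in\mathcal D$, and constants $\delta>1$, $0<C_0<\infty$, $0<\varepsilon<1$ such that: $X=\bigcup_{Q\in\mathcal D_k}Q$ for each $k$; two cubes that intersect are nested; every $Q\in\mathcal D_k$ has at least one child in $\mathcal D_{k-1}$ contained in $Q$ and exactly one parent in $\mathcal D_{k+1}$ containing $Q$; $\mu(Q_2)\ge\varepsilon\mu(Q_1)$ if $Q_2$ is a child of $Q_1$; $B(x_c(Q),\delta^k)\subset Q\subset B(x_c(Q),C_0\delta^k)$ for $Q\in\mathcal D_k$. Fix finitely many dyadic decompositions of $X$ with common constants; "cube" means a member of one of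 them. $Mf(x)=\sup_{Q\ni x}\frac1{\mu(Q)}\int_Q|f|\,d\mu$, sup over cubes. A weight is a locally integrable function with values in $(0,\infty)$ a.e.; $w(Q)=\int_Qw\,d\mu$; $[w]_{A_\infty}=\sup_Q\frac1{w(Q)}\int_QM(w\chi_Q)\,d\mu$, sup over cubes, and $w\in A_\infty$ means $[w]_{A_\infty}<\infty$. *)

theory Defs
  imports "HOL-Analysis.Analysis"
begin

text \<open>The underlying set of the space of homogeneous type is \<^term>\<open>space M\<close>.\<close>

definition qball :: "'a measure \<Rightarrow> ('a \<Rightarrow> 'a \<Rightarrow> real) \<Rightarrow> 'a \<Rightarrow> real \<Rightarrow> 'a set" where
  "qball M \<rho> x r = {y \<in> space M. \<rho> x y < r}"

definition qopen :: "'a measure \<Rightarrow> ('a \<Rightarrow> 'a \<Rightarrow> real) \<Rightarrow> 'a set \<Rightarrow> bool" where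
  "qopen M \<rho> U \<longleftrightarrow> U \<subseteq> space M \<and> (\<forall>x\<in>U. \<exists>r>0. qball M \<rho> x r \<subseteq> U)"

definition qborel_sets :: "'a measure \<Rightarrow> ('a \<Rightarrow> 'a \<Rightarrow> real) \<Rightarrow> 'a set set" where
  "qborel_sets M \<rho> = sigma_sets (space M) {U. qopen M \<rho> U}"

text \<open>
  The measure is a Borel measure for the quasimetric topology, up to null sets; Borel measures,
  their completions and Borel regular measures all qualify.  This is the usual convention under
  which the Lebesgue differentiation theorem is valid in a space of homogeneous type.  Balls for a
  quasimetric need not be Borel sets, so their measurability is a separate requirement.
\<close>

locale homogeneous_type_space =
  fixes M :: "'a measure" and \<rho> :: "'a \<Rightarrow> 'a \<Rightarrow> real" and \<kappa> D\<mu> :: real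
  assumes rho_nonneg: "\<lbrakk>x \<in> space M; y \<in> space M\<rbrakk> \<Longrightarrow> 0 \<le> \<rho> x y"
    and rho_eq_0_iff: "\<lbrakk>x \<in> space M; y \<in> space M\<rbrakk> \<Longrightarrow> \<rho> x y = 0 \<longleftrightarrow> x = y"
    and rho_sym: "\<lbrakk>x \<in> space M; y \<in> space M\<rbrakk> \<Longrightarrow> \<rho> x y = \<rho> y x"
    and rho_quasi_triangle:
      "\<lbrakk>x \<in> space M; y \<in> space M; z \<in> space M\<rbrakk> \<Longrightarrow> \<rho> x z \<le> \<kappa> * (\<rho> x y + \<rho> y z)"
    and qborel_measurable: "qborel_sets M \<rho> \<subseteq> sets M"
    and qborel_up_to_null:
      "A \<in> sets M \<Longrightarrow> \<exists>B \<in> qborel_sets M \<rho>. (A - B) \<union> (B - A) \<in> null_sets M"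
    and qball_measurable: "\<lbrakk>x \<in> space M; 0 < r\<rbrakk> \<Longrightarrow> qball M \<rho> x r \<in> sets M"
    and qball_pos: "\<lbrakk>x \<in> space M; 0 < r\<rbrakk> \<Longrightarrow> 0 < emeasure M (qball M \<rho> x (2 * r))"
    and doubling: "\<lbrakk>x \<in> space M; 0 < r\<rbrakk> \<Longrightarrow>
      emeasure M (qball M \<rho> x (2 * r)) \<le> ennreal D\<mu> * emeasure M (qball M \<rho> x r)"
    and qball_finite: "\<lbrakk>x \<in> space M; 0 < r\<rbrakk> \<Longrightarrow>
      ennreal D\<mu> * emeasure M (qball M \<rho> x r) < \<infinity>"

text \<open>
  \<open>\<D> k\<close> is the \<open>k\<close>-th generation.  One set may belong to several generations (for instance an
  isolated point, or the whole space if it is bounded); the centre is therefore allowed to depend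
  on the generation as well.  Disjointness of distinct cubes of one generation is not listed: it
  follows from the existence of children and the uniqueness of parents.
\<close>

definition dyadic_decomposition ::
    "'a measure \<Rightarrow> ('a \<Rightarrow> 'a \<Rightarrow> real) \<Rightarrow> real \<Rightarrow> real \<Rightarrow> real \<Rightarrow>
     (int \<Rightarrow> 'a set set) \<Rightarrow> (int \<Rightarrow> 'a set \<Rightarrow> 'a) \<Rightarrow> bool" where
  "dyadic_decomposition M \<rho> \<delta> C0 \<epsilon> \<D> xc \<longleftrightarrow>
     1 < \<delta> \<and> 0 < C0 \<and> 0 < \<epsilon> \<and> \<epsilon> < 1 \<and>
     (\<forall>k. \<D> k \<subseteq> sets M) \<and>
     (\<forall>k. \<Union>(\<D> k) = space M) \<and>
     (\<forall>k l. \<forall>P\<in>\<D> k. \<forall>Q\<in>\<D> l. P \<inter> Q \<noteq> {} \<longrightarrow> P \<subseteq> Q \<or> Q \<subseteq> P) \<and>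
     (\<forall>k. \<forall>Q\<in>\<D> k. \<exists>R\<in>\<D> (k - 1). R \<subseteq> Q) \<and>
     (\<forall>k. \<forall>Q\<in>\<D> k. \<exists>!P. P \<in> \<D> (k + 1) \<and> Q \<subseteq> P) \<and>
     (\<forall>k. \<forall>Q1\<in>\<D> k. \<forall>Q2\<in>\<D> (k - 1).
        Q2 \<subseteq> Q1 \<longrightarrow> ennreal \<epsilon> * emeasure M Q1 \<le> emeasure M Q2) \<and>
     (\<forall>k. \<forall>Q\<in>\<D> k. xc k Q \<in> space M \<and>
        qball M \<rho> (xc k Q) (\<delta> powi k) \<subseteq> Q \<and> Q \<subseteq> qball M \<rho> (xc k Q) (C0 * \<delta> powi k))"

definition cubes :: "'i set \<Rightarrow> ('i \<Rightarrow> int \<Rightarrow> 'a set set) \<Rightarrow> 'a set set" where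
  "cubes I \<D> = (\<Union>i\<in>I. \<Union>k. \<D> i k)"

text \<open>Below, \<open>\<Q>\<close> is the collection of all cubes.\<close>

definition maximal_function ::
    "'a measure \<Rightarrow> 'a set set \<Rightarrow> ('a \<Rightarrow> real) \<Rightarrow> 'a \<Rightarrow> ennreal" where
  "maximal_function M \<Q> f x =
     (SUP Q\<in>{Q\<in>\<Q>. x \<in> Q}. (\<integral>\<^sup>+y\<in>Q. ennreal \<bar>f y\<bar> \<partial>M) / emeasure M Q)"

text \<open>Locally integrable means integrable on every ball.\<close>

definition weight :: "'a measure \<Rightarrow> ('a \<Rightarrow> 'a \<Rightarrow> real) \<Rightarrow> ('a \<Rightarrow> real) \<Rightarrow> bool" where
  "weight M \<rho> w \<longleftrightarrow>
     w \<in> borel_measurable M \<and>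
     (\<forall>x\<in>space M. \<forall>r>0. set_integrable M (qball M \<rho> x r) w) \<and>
     (AE x in M. 0 < w x)"

definition A_infty_const :: "'a measure \<Rightarrow> 'a set set \<Rightarrow> ('a \<Rightarrow> real) \<Rightarrow> ennreal" where
  "A_infty_const M \<Q> w =
     (SUP Q\<in>\<Q>. (\<integral>\<^sup>+x\<in>Q. maximal_function M \<Q> (\<lambda>y. w y * indicator Q y) x \<partial>M)
              / (\<integral>\<^sup>+x\<in>Q. ennreal (w x) \<partial>M))"

definition A_infty ::
    "'a measure \<Rightarrow> ('a \<Rightarrow> 'a \<Rightarrow> real) \<Rightarrow> 'a set set \<Rightarrow> ('a \<Rightarrow> real) \<Rightarrow> bool" where
  "A_infty M \<rho> \<Q> w \<longleftrightarrow> weight M \<rho> w \<and> A_infty_const M \<Q> w < \<infinity>"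

end

theory Submission
  imports Defs
begin

text \<open>
  Fix the cube \<open>Q\<close> and work inside the one dyadic decomposition it belongs to.  Let \<open>m\<close> be the
  dyadic maximal function of \<open>w\<close> over the cubes of that decomposition contained in \<open>Q\<close>, and \<open>s\<close>
  the mean of \<open>w\<close> over \<open>Q\<close>.  Write \<open>A = [w]\<close> for the \<open>A\<^sub>\<infinity>\<close> constant.

  For \<open>l \<ge> s\<close> the set \<open>{m > l}\<close> is the disjoint union of the maximal (stopping) cubes with mean
  above \<open>l\<close>.  The parent of a stopping cube has mean at most \<open>l\<close>, so the mean of the stopping cube
  is at most \<open>D l\<close>; summation gives \<open>w{m > l} \<le> D l \<mu>{m > l}\<close> (\<open>nn_integral_upper_level_le\<close>).
  On a stopping cube \<open>P\<close> the cubes containing \<open>P\<close> do not matter for \<open>m\<close>, so there \<open>m\<close> is at most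
  \<open>M(w \<chi>\<^sub>P)\<close>, and the \<open>A\<^sub>\<infinity>\<close> condition on \<open>P\<close> gives
  \<open>\<integral>\<^bsub>{m > l}\<^esub> m \<le> A w{m > l}\<close> (\<open>nn_integral_dyadic_max_upper_level_le\<close>).

  A truncated layer-cake formula (\<open>nn_integral_truncated_powr_le\<close>) turns the resulting bound
  \<open>\<integral>\<^bsub>{m > l}\<^esub> m \<le> A D l \<mu>{m > l}\<close> into
  \<open>X \<le> s\<^sup>r A w(Q) + A D r / (1 + r) X\<close>, where \<open>X\<close> is the integral of \<open>m min(m, T)\<^sup>r\<close> over \<open>Q\<close>.
  The restriction on \<open>r\<close> says exactly that \<open>A D r / (1 + r) \<le> 1/2\<close>, and \<open>X\<close> is finite thanks to
  the truncation, so \<open>X \<le> 2 A s\<^sup>r w(Q)\<close>.  The same formula applied to \<open>w\<close> then gives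
  \<open>\<integral> w min(m, T)\<^sup>r \<le> s\<^sup>r w(Q) + D r / (1 + r) X \<le> 2 s\<^sup>r w(Q)\<close>, uniformly in \<open>T\<close>
  (\<open>nn_integral_powr_le_of_dyadic_max\<close>).

  It remains to let \<open>T\<close> tend to infinity and to use \<open>w \<le> m\<close> almost everywhere, which is the only
  trace of Lebesgue differentiation.  It is proved directly: on \<open>E = {m \<le> a < w}\<close>, cover \<open>E\<close> up to
  small measure by disjoint cubes meeting \<open>E\<close>; each of them has mean at most \<open>a\<close>, whence
  \<open>\<integral>\<^sub>E w \<le> a \<mu>(E)\<close> and \<open>E\<close> is null (\<open>AE_le_dyadic_max\<close>).  Such coverings exist because small cubes
  fit into open sets, so that the cubes generate the measurable sets up to null sets
  (\<open>sets_up_to_null\<close>, \<open>outer_approx_cube_open\<close>).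
\<close>

section \<open>A truncated layer-cake inequality\<close>
text \<open>
  The point \<open>t\<close> has Lebesgue measure zero, so the domain is \<open>{s..min t T}\<close>.  Starting the layers at
  \<open>s > 0\<close> stays away from the singularity of the density at the origin when \<open>c < 1\<close>.
\<close>

lemma nn_integral_powr_truncated:
  fixes c s t T :: real
  assumes s: "0 < s" and c: "0 < c"
  shows "(\<integral>\<^sup>+l. ennreal (c * l powr (c - 1)) * indicator ({s..T} \<inter> {..<t}) l \<partial>lborel)
    = ennreal (max s (min t T) powr c - s powr c)"
proof (cases "min t T < s")
  case True
  then have "{s..T} \<inter> {..<t} = {}" by auto
  moreover have "max s (min t T) = s" using True by linarith
  ultimately show ?thesis by simp
next
  case False
  have "(\<integral>\<^sup>+l. ennreal (c * l powr (c - 1)) * indicator ({s..T} \<inter> {..<t}) l \<partial>lborel)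
      = (\<integral>\<^sup>+l. ennreal (c * l powr (c - 1)) * indicator {s..min t T} l \<partial>lborel)"
  proof (rule nn_integral_cong_AE)
    have "AE l in lborel. l \<noteq> t" by (rule AE_lborel_singleton)
    then show "AE l in lborel. ennreal (c * l powr (c - 1)) * indicator ({s..T} \<inter> {..<t}) l
        = ennreal (c * l powr (c - 1)) * indicator {s..min t T} l"
      by eventually_elim (auto simp: indicator_def)
  qed
  also have "\<dots> = ennreal (min t T powr c - s powr c)"
  proof (rule nn_integral_FTC_Icc)
    fix x assume "x \<in> {s..min t T}"
    then have "0 < x" using s by simp
    then show "((\<lambda>x. x powr c) has_real_derivative c * x powr (c - 1)) (at x)"
      by (auto intro!: derivative_eq_intros simp: powr_diff)
  qed (use c False in auto)
  also have "min t T = max s (min t T)" using False by linarith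
  finally show ?thesis .
qed

text \<open>
  Write \<open>min (f x) T powr r\<close> as an integral of \<open>r l powr (r - 1)\<close> over the levels \<open>l < f x\<close>: levels below
  \<open>s\<close> contribute at most \<open>s powr r\<close>, and on the others Tonelli's theorem brings in the \<open>h\<close>-integral
  over \<open>{f > l}\<close>, which the level estimate trades for \<open>K l\<close> times the measure of \<open>{f > l}\<close>.
  Reading the layer-cake formula backwards, now with exponent \<open>1 + r\<close>, gives the last term; the
  factor \<open>r / (1 + r)\<close> is the ratio of the two densities \<open>r l powr r\<close> and \<open>(1 + r) l powr r\<close>.  The
  truncation at \<open>T\<close> is there so that the right-hand side can be absorbed when \<open>h = f\<close>.
\<close>

lemma nn_integral_truncated_powr_le:
  fixes f :: "'a \<Rightarrow> real" and h :: "'a \<Rightarrow> ennreal" and s r T K :: real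
  assumes "sigma_finite_measure N"
    and [measurable]: "f \<in> borel_measurable N" "h \<in> borel_measurable N"
    and f: "\<And>x. 0 \<le> f x" and s: "0 < s" and r: "0 < r" and K: "0 \<le> K" and T: "0 \<le> T"
    and level: "\<And>l. s \<le> l \<Longrightarrow>
      (\<integral>\<^sup>+x\<in>{x\<in>space N. l < f x}. h x \<partial>N) \<le> ennreal (K * l) * emeasure N {x\<in>space N. l < f x}"
  shows "(\<integral>\<^sup>+x. h x * ennreal (min (f x) T powr r) \<partial>N)
    \<le> ennreal (s powr r) * (\<integral>\<^sup>+x. h x \<partial>N)
      + ennreal (K * r / (1 + r)) * (\<integral>\<^sup>+x. ennreal (min (f x) T powr (1 + r)) \<partial>N)"
proof -
  interpret sigma_finite_measure N by fact
  interpret NL: pair_sigma_finite N lborel ..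
  let ?J = "\<lambda>x. {s..T} \<inter> {..<f x}"
  have ind: "indicator (?J x) l = indicator {s..T} l * (indicator {l. l < f x} l :: ennreal)" for x l
    by (auto simp: indicator_def)
  have [measurable]: "Measurable.pred (N \<Otimes>\<^sub>M lborel) (\<lambda>(x, l). l < f x)" by measurable
  have swap: "(\<integral>\<^sup>+x. (\<integral>\<^sup>+l. g x * k l * indicator (?J x) l \<partial>lborel) \<partial>N)
      = (\<integral>\<^sup>+l. k l * indicator {s..T} l * (\<integral>\<^sup>+x\<in>{x\<in>space N. l < f x}. g x \<partial>N) \<partial>lborel)"
    if [measurable]: "g \<in> borel_measurable N" "k \<in> borel_measurable borel" for g :: "'a \<Rightarrow> ennreal" and k
  proof -
    have "(\<integral>\<^sup>+x. (\<integral>\<^sup>+l. g x * k l * indicator (?J x) l \<partial>lborel) \<partial>N)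
        = (\<integral>\<^sup>+l. (\<integral>\<^sup>+x. g x * k l * indicator (?J x) l \<partial>N) \<partial>lborel)"
      unfolding ind by (rule NL.Fubini'[symmetric]) measurable
    also have "\<dots> = (\<integral>\<^sup>+l. k l * indicator {s..T} l * (\<integral>\<^sup>+x\<in>{x\<in>space N. l < f x}. g x \<partial>N) \<partial>lborel)"
    proof (rule nn_integral_cong)
      fix l
      show "(\<integral>\<^sup>+x. g x * k l * indicator (?J x) l \<partial>N)
          = k l * indicator {s..T} l * (\<integral>\<^sup>+x\<in>{x\<in>space N. l < f x}. g x \<partial>N)"
        by (subst nn_integral_cmult[symmetric])
          (auto intro!: nn_integral_cong simp: indicator_def mult.commute)
    qed
    finally show ?thesis .
  qed
  have low: "ennreal (min (f x) T powr r)
      \<le> ennreal (s powr r) + (\<integral>\<^sup>+l. ennreal (r * l powr (r - 1)) * indicator (?J x) l \<partial>lborel)" for x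
  proof -
    have "min (f x) T powr r \<le> max s (min (f x) T) powr r"
      using r T f[of x] by (intro powr_mono2) auto
    moreover have "s powr r \<le> max s (min (f x) T) powr r" using s r by (intro powr_mono2) auto
    ultimately show ?thesis
      unfolding nn_integral_powr_truncated[OF s r]
      by (subst ennreal_plus[symmetric]) (auto intro!: ennreal_leI)
  qed
  have high: "(\<integral>\<^sup>+l. ennreal (r * l powr r) * indicator (?J x) l \<partial>lborel)
      \<le> ennreal (r / (1 + r)) * ennreal (min (f x) T powr (1 + r))" for x
  proof -
    have "(\<integral>\<^sup>+l. ennreal (r * l powr r) * indicator (?J x) l \<partial>lborel)
        = (\<integral>\<^sup>+l. ennreal (r / (1 + r)) * (ennreal ((1 + r) * l powr (1 + r - 1)) * indicator (?J x) l) \<partial>lborel)"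
      using r by (intro nn_integral_cong) (auto simp: indicator_def ennreal_mult[symmetric])
    also have "\<dots> = ennreal (r / (1 + r)) * ennreal (max s (min (f x) T) powr (1 + r) - s powr (1 + r))"
      using r by (subst nn_integral_cmult) (auto simp: nn_integral_powr_truncated[OF s, of "1 + r", unfolded add_diff_cancel_left'])
    also have "\<dots> \<le> ennreal (r / (1 + r)) * ennreal (min (f x) T powr (1 + r))"
      by (intro mult_left_mono ennreal_leI) (auto simp: max_def)
    finally show ?thesis .
  qed
  have "(\<integral>\<^sup>+x. h x * ennreal (min (f x) T powr r) \<partial>N)
      \<le> (\<integral>\<^sup>+x. ennreal (s powr r) * h x + (\<integral>\<^sup>+l. h x * ennreal (r * l powr (r - 1)) * indicator (?J x) l \<partial>lborel) \<partial>N)"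
  proof (rule nn_integral_mono)
    fix x
    have "h x * ennreal (min (f x) T powr r)
        \<le> h x * (ennreal (s powr r) + (\<integral>\<^sup>+l. ennreal (r * l powr (r - 1)) * indicator (?J x) l \<partial>lborel))"
      by (intro mult_left_mono low) simp
    also have "\<dots> = h x * ennreal (s powr r)
        + h x * (\<integral>\<^sup>+l. ennreal (r * l powr (r - 1)) * indicator (?J x) l \<partial>lborel)"
      by (rule distrib_left)
    also have "h x * (\<integral>\<^sup>+l. ennreal (r * l powr (r - 1)) * indicator (?J x) l \<partial>lborel)
        = (\<integral>\<^sup>+l. h x * ennreal (r * l powr (r - 1)) * indicator (?J x) l \<partial>lborel)"
      by (subst nn_integral_cmult[symmetric]) (auto simp: mult.assoc)
    finally show "h x * ennreal (min (f x) T powr r)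
        \<le> ennreal (s powr r) * h x + (\<integral>\<^sup>+l. h x * ennreal (r * l powr (r - 1)) * indicator (?J x) l \<partial>lborel)"
      by (simp add: mult.commute)
  qed
  also have "\<dots> = ennreal (s powr r) * (\<integral>\<^sup>+x. h x \<partial>N)
      + (\<integral>\<^sup>+x. (\<integral>\<^sup>+l. h x * ennreal (r * l powr (r - 1)) * indicator (?J x) l \<partial>lborel) \<partial>N)"
    unfolding ind by (subst nn_integral_add) (auto simp: nn_integral_cmult)
  also have "(\<integral>\<^sup>+x. (\<integral>\<^sup>+l. h x * ennreal (r * l powr (r - 1)) * indicator (?J x) l \<partial>lborel) \<partial>N)
      = (\<integral>\<^sup>+l. ennreal (r * l powr (r - 1)) * indicator {s..T} l * (\<integral>\<^sup>+x\<in>{x\<in>space N. l < f x}. h x \<partial>N) \<partial>lborel)"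
    by (rule swap) measurable
  also have "\<dots> \<le> (\<integral>\<^sup>+l. ennreal K * ennreal (r * l powr r) * indicator {s..T} l *
      (\<integral>\<^sup>+x\<in>{x\<in>space N. l < f x}. 1 \<partial>N) \<partial>lborel)"
  proof (rule nn_integral_mono)
    fix l :: real
    show "ennreal (r * l powr (r - 1)) * indicator {s..T} l * (\<integral>\<^sup>+x\<in>{x\<in>space N. l < f x}. h x \<partial>N)
        \<le> ennreal K * ennreal (r * l powr r) * indicator {s..T} l * (\<integral>\<^sup>+x\<in>{x\<in>space N. l < f x}. 1 \<partial>N)"
    proof (cases "l \<in> {s..T}")
      case True
      then have l: "s \<le> l" "0 < l" using s by auto
      have "ennreal (r * l powr (r - 1)) * (\<integral>\<^sup>+x\<in>{x\<in>space N. l < f x}. h x \<partial>N)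
          \<le> ennreal (r * l powr (r - 1)) * (ennreal (K * l) * emeasure N {x\<in>space N. l < f x})"
        by (intro mult_left_mono level l) simp
      also have "\<dots> = ennreal (r * l powr (r - 1) * (K * l)) * emeasure N {x\<in>space N. l < f x}"
        using r K l by (subst ennreal_mult) (auto simp: mult.assoc)
      also have "r * l powr (r - 1) * (K * l) = K * (r * l powr r)"
        using l by (simp add: powr_diff)
      finally show ?thesis using True K r by (simp add: ennreal_mult)
    qed simp
  qed
  also have "\<dots> = (\<integral>\<^sup>+x. (\<integral>\<^sup>+l. 1 * (ennreal K * ennreal (r * l powr r)) * indicator (?J x) l \<partial>lborel) \<partial>N)"
    by (rule swap[symmetric]) measurable
  also have "\<dots> = ennreal K * (\<integral>\<^sup>+x. (\<integral>\<^sup>+l. ennreal (r * l powr r) * indicator (?J x) l \<partial>lborel) \<partial>N)"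
    unfolding ind by (simp add: nn_integral_cmult mult.assoc)
  also have "\<dots> \<le> ennreal K * (\<integral>\<^sup>+x. ennreal (r / (1 + r)) * ennreal (min (f x) T powr (1 + r)) \<partial>N)"
    by (intro mult_left_mono nn_integral_mono high) simp
  also have "\<dots> = ennreal (K * r / (1 + r)) * (\<integral>\<^sup>+x. ennreal (min (f x) T powr (1 + r)) \<partial>N)"
    using K r by (subst nn_integral_cmult) (auto simp: mult.assoc[symmetric] ennreal_mult[symmetric])
  finally show ?thesis by (simp add: add_left_mono)
qed
section \<open>Outer approximation and disjoint families\<close>

text \<open>
  Regularity, with the members of \<open>\<G>\<close> in the role of open sets.  The sets \<open>B\<close> that can be enclosed
  between complements of members of \<open>\<G>\<close> and members of \<open>\<G>\<close> with small difference form a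
  \<open>\<sigma>\<close>-algebra, and generators are both open and closed.  Approximation from inside is carried along
  because complements exchange it with approximation from outside.
\<close>

lemma sigma_sets_approx:
  assumes "finite_measure N"
    and G_sets: "\<G> \<subseteq> sets N"
    and G_empty: "{} \<in> \<G>" and G_space: "space N \<in> \<G>"
    and G_Un: "\<And>A :: nat \<Rightarrow> 'a set. range A \<subseteq> \<G> \<Longrightarrow> (\<Union>n. A n) \<in> \<G>"
    and G_Int: "\<And>A B. A \<in> \<G> \<Longrightarrow> B \<in> \<G> \<Longrightarrow> A \<inter> B \<in> \<G>"
    and C: "\<And>A. A \<in> \<C> \<Longrightarrow> A \<in> \<G> \<and> space N - A \<in> \<G>"
    and B: "B \<in> sigma_sets (space N) \<C>"
    and e: "0 < (e :: real)"
  shows "\<exists>U\<in>\<G>. \<exists>V\<in>\<G>. B \<subseteq> U \<and> space N - B \<subseteq> V \<and> measure N (U \<inter> V) < e"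
proof -
  interpret finite_measure N by fact
  show ?thesis using B e
  proof (induction arbitrary: e)
    case (Basic A)
    then show ?case using C[of A] by (intro bexI[of _ A] bexI[of _ "space N - A"]) auto
  next
    case Empty
    then show ?case using G_empty G_space by (intro bexI[of _ "{}"] bexI[of _ "space N"]) auto
  next
    case (Compl A)
    then obtain U V where "U \<in> \<G>" "V \<in> \<G>" "A \<subseteq> U" "space N - A \<subseteq> V" "measure N (U \<inter> V) < e"
      by blast
    then show ?case by (intro bexI[of _ V] bexI[of _ U]) (auto simp: Int_commute)
  next
    case (Union A)
    have "\<forall>n. \<exists>U V. U \<in> \<G> \<and> V \<in> \<G> \<and> A n \<subseteq> U \<and> space N - A n \<subseteq> V \<and>
        measure N (U \<inter> V) < e / 2 * (1/2) ^ Suc n"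
    proof
      fix n
      have "0 < e / 2 * (1/2) ^ Suc n" using \<open>0 < e\<close> by simp
      from Union.IH[OF this] show "\<exists>U V. U \<in> \<G> \<and> V \<in> \<G> \<and> A n \<subseteq> U \<and> space N - A n \<subseteq> V \<and>
        measure N (U \<inter> V) < e / 2 * (1/2) ^ Suc n" by blast
    qed
    then obtain U V where U: "\<And>n. U n \<in> \<G>" and V: "\<And>n. V n \<in> \<G>" and AU: "\<And>n. A n \<subseteq> U n"
      and AV: "\<And>n. space N - A n \<subseteq> V n" and UV: "\<And>n. measure N (U n \<inter> V n) < e / 2 * (1/2) ^ Suc n"
      by metis
    \<comment> \<open>Only finitely many closed inner sets may be united, so the right index is found
      by letting \<open>m\<close> tend to infinity and using continuity from above.\<close>
    define W where "W m = (\<Union>n. U n) \<inter> (\<Inter>n\<le>m. V n)" for m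
    have U_sets [measurable]: "U n \<in> sets N" and V_sets [measurable]: "V n \<in> sets N" for n
      using U V G_sets by auto
    have W_sets: "W m \<in> sets N" for m unfolding W_def by measurable
    have VG: "(\<Inter>n\<le>m. V n) \<in> \<G>" for m
      by (induction m) (auto simp: V atMost_Suc intro!: G_Int)
    have "decseq W" unfolding W_def decseq_def by force
    then have lim: "(\<lambda>m. measure N (W m)) \<longlonglongrightarrow> measure N (\<Inter>m. W m)"
      using W_sets by (intro finite_Lim_measure_decseq) auto
    have half: "(\<lambda>n. e / 2 * (1/2) ^ Suc n) sums (e / 2)"
      using sums_mult[OF power_half_series, of "e/2"] by simp
    have summ: "summable (\<lambda>n. measure N (U n \<inter> V n))"
      by (rule summable_comparison_test'[OF sums_summable[OF half]]) (use UV in \<open>auto intro: less_imp_le\<close>)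
    have "measure N (\<Inter>m. W m) \<le> measure N (\<Union>n. U n \<inter> V n)"
      by (intro finite_measure_mono) (auto simp: W_def)
    also have "\<dots> \<le> (\<Sum>n. measure N (U n \<inter> V n))"
      using summ by (intro finite_measure_subadditive_countably) auto
    also have "\<dots> \<le> e / 2"
      using suminf_le[OF less_imp_le[OF UV] summ sums_summable[OF half]] half by (simp add: sums_iff)
    also have "\<dots> < e" using \<open>0 < e\<close> by simp
    finally obtain m where "measure N (W m) < e"
      using order_tendstoD(2)[OF lim] by (metis eventually_sequentially order_refl)
    moreover have "(\<Union>n. U n) \<in> \<G>" using G_Un[of U] U by auto
    moreover have "(\<Union>n. A n) \<subseteq> (\<Union>n. U n)" using AU by blast
    moreover have "space N - (\<Union>n. A n) \<subseteq> (\<Inter>n\<le>m. V n)" using AV by blast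
    ultimately show ?case unfolding W_def using VG[of m] by blast
  qed
qed

lemma nn_integral_disjoint_mono:
  assumes "countable S" "S \<subseteq> sets N" "disjoint S"
    and [measurable]: "f \<in> borel_measurable N" "g \<in> borel_measurable N"
    and "\<And>c. c \<in> S \<Longrightarrow> (\<integral>\<^sup>+x\<in>c. f x \<partial>N) \<le> (\<integral>\<^sup>+x\<in>c. g x \<partial>N)"
  shows "(\<integral>\<^sup>+x\<in>\<Union>S. f x \<partial>N) \<le> (\<integral>\<^sup>+x\<in>\<Union>S. g x \<partial>N)"
proof -
  have S: "c \<in> sets N" if "c \<in> S" for c using that assms(2) by auto
  then have US: "\<Union>S \<in> sets N" using assms(1) by (simp add: sets.countable_Union assms(2))
  have eq: "(\<integral>\<^sup>+x\<in>\<Union>S. h x \<partial>N) = (\<integral>\<^sup>+c. (\<integral>\<^sup>+x\<in>c. h x \<partial>N) \<partial>count_space S)"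
    if [measurable]: "h \<in> borel_measurable N" for h
  proof -
    have "(\<integral>\<^sup>+x\<in>\<Union>S. h x \<partial>N) = emeasure (density N h) (\<Union>c\<in>S. c)"
      using US by (simp add: emeasure_density)
    also have "\<dots> = (\<integral>\<^sup>+c. emeasure (density N h) c \<partial>count_space S)"
      using assms(1,3) S by (intro emeasure_UN_countable) (auto simp: disjoint_def disjoint_family_on_def)
    also have "\<dots> = (\<integral>\<^sup>+c. (\<integral>\<^sup>+x\<in>c. h x \<partial>N) \<partial>count_space S)"
      using S by (intro nn_integral_cong) (simp add: emeasure_density)
    finally show ?thesis .
  qed
  show ?thesis
    unfolding eq[OF assms(4)] eq[OF assms(5)] by (rule nn_integral_mono) (simp add: assms(6))
qed

section \<open>Nested partitions and stopping cubes\<close>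

text \<open>
  Partitions of the whole space, each refining the preceding one, given through the cell
  \<open>cube n x\<close> of the \<open>n\<close>-th partition that contains \<open>x\<close>.  The dyadic descendants of a fixed cube are
  the intended instance.
\<close>

locale nested_partitions = finite_measure N for N :: "'a measure" +
  fixes cube :: "nat \<Rightarrow> 'a \<Rightarrow> 'a set"
  assumes cube_sets: "x \<in> space N \<Longrightarrow> cube n x \<in> sets N"
    and cube_self: "x \<in> space N \<Longrightarrow> x \<in> cube n x"
    and cube_eq: "x \<in> space N \<Longrightarrow> y \<in> cube n x \<Longrightarrow> cube n y = cube n x"
    and cube_Suc: "x \<in> space N \<Longrightarrow> cube (Suc n) x \<subseteq> cube n x"
    and cube_0: "x \<in> space N \<Longrightarrow> cube 0 x = space N"
    and cube_pos: "x \<in> space N \<Longrightarrow> emeasure N (cube n x) \<noteq> 0"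
begin

lemma cube_space: "x \<in> space N \<Longrightarrow> y \<in> cube n x \<Longrightarrow> y \<in> space N"
  using cube_sets sets.sets_into_space by blast

lemma cube_mono: "x \<in> space N \<Longrightarrow> n \<le> k \<Longrightarrow> cube k x \<subseteq> cube n x"
  by (rule lift_Suc_antimono_le) (rule cube_Suc)

lemma cube_coarser: "x \<in> space N \<Longrightarrow> y \<in> cube k x \<Longrightarrow> n \<le> k \<Longrightarrow> cube n y = cube n x"
  using cube_mono cube_eq by blast

definition all_cubes :: "'a set set" where
  "all_cubes = (\<Union>n. cube n ` space N)"

text \<open>
  Cells of one generation are disjoint and have positive measure, so in a space of finite measure their measures
  form a summable family without zero terms.
\<close>

lemma countable_all_cubes: "countable all_cubes"
proof -
  have "countable (cube n ` space N)" (is "countable ?S") for n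
  proof -
    have dis: "disjoint ?S"
      unfolding disjoint_def by (metis cube_eq disjoint_iff image_iff)
    have S: "c \<in> sets N" "measure N c \<noteq> 0" if "c \<in> ?S" for c
      using that cube_sets cube_pos by (auto simp: emeasure_eq_measure)
    have "(\<lambda>c. measure N c) summable_on ?S"
    proof (rule nonneg_bdd_above_summable_on)
      show "bdd_above (sum (measure N) ` {F. F \<subseteq> ?S \<and> finite F})"
      proof (rule bdd_aboveI2[of _ _ "measure N (space N)"])
        fix F assume F: "F \<in> {F. F \<subseteq> ?S \<and> finite F}"
        then have "sum (measure N) F = measure N (\<Union>c\<in>F. c)"
          using S pairwise_subset[OF dis, of F]
          by (intro finite_measure_finite_Union[symmetric]) (auto simp: disjoint_def disjoint_family_on_def)
        then show "sum (measure N) F \<le> measure N (space N)" by (simp add: bounded_measure)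
      qed
    qed auto
    then have "countable {c\<in>?S. measure N c \<noteq> 0}"
      by (intro abs_summable_countable) (auto simp: summable_on_iff_abs_summable_on_real[symmetric])
    moreover have "{c\<in>?S. measure N c \<noteq> 0} = ?S" using S by auto
    ultimately show ?thesis by simp
  qed
  then show ?thesis unfolding all_cubes_def by auto
qed

lemma all_cubes_sets: "all_cubes \<subseteq> sets N"
  using cube_sets by (auto simp: all_cubes_def)

text \<open>
  The open sets of the topology generated by the cells; a cell is both open and closed in it.
\<close>

definition cube_open :: "'a set set" where
  "cube_open = {U. U \<subseteq> space N \<and> (\<forall>x\<in>U. \<exists>n. cube n x \<subseteq> U)}"

lemma cube_open_eq_Union:
  assumes "U \<in> cube_open"
  shows "U = \<Union>{c\<in>all_cubes. c \<subseteq> U}"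
  proof (intro equalityI subsetI)
  fix x assume x: "x \<in> U"
  then obtain n where "x \<in> space N" "cube n x \<subseteq> U" using assms unfolding cube_open_def by blast
  then show "x \<in> \<Union>{c\<in>all_cubes. c \<subseteq> U}"
    using cube_self by (auto simp: all_cubes_def intro!: bexI[of _ "cube n x"])
qed auto

lemma cube_open_sigma_sets: "cube_open \<subseteq> sigma_sets (space N) all_cubes"
proof
  fix U assume U: "U \<in> cube_open"
  have "countable {c\<in>all_cubes. c \<subseteq> U}"
    using countable_all_cubes by (rule countable_subset[rotated]) auto
  then have "\<Union>{c\<in>all_cubes. c \<subseteq> U} \<in> sigma_sets (space N) all_cubes"
    by (rule sigma_sets_UNION) auto
  then show "U \<in> sigma_sets (space N) all_cubes" using cube_open_eq_Union[OF U] by simp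
qed

lemma cube_open_sets: "cube_open \<subseteq> sets N"
  using cube_open_sigma_sets sets.sigma_sets_subset[OF all_cubes_sets] by blast

lemma outer_approx_cube_open:
  assumes "B \<in> sigma_sets (space N) all_cubes" "0 < (e::real)"
  obtains U where "U \<in> cube_open" "B \<subseteq> U" "measure N U < measure N B + e"
proof -
  have "\<exists>U\<in>cube_open. \<exists>V\<in>cube_open. B \<subseteq> U \<and> space N - B \<subseteq> V \<and> measure N (U \<inter> V) < e"
  proof (rule sigma_sets_approx[OF finite_measure_axioms cube_open_sets _ _ _ _ _ assms])
    show "{} \<in> cube_open" by (simp add: cube_open_def)
    show "space N \<in> cube_open" using cube_0 by (auto simp: cube_open_def)
  next
    fix A :: "nat \<Rightarrow> 'a set" assume "range A \<subseteq> cube_open"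
    then have "A n \<in> cube_open" for n by auto
    then show "(\<Union>n. A n) \<in> cube_open"
      unfolding cube_open_def mem_Collect_eq by (meson UN_E UN_least UN_upper UNIV_I subset_trans)
  next
    fix A B assume AB: "A \<in> cube_open" "B \<in> cube_open"
    show "A \<inter> B \<in> cube_open" unfolding cube_open_def
    proof safe
      fix x assume x: "x \<in> A" "x \<in> B"
      then obtain n k where nk: "cube n x \<subseteq> A" "cube k x \<subseteq> B" and xs: "x \<in> space N"
        using AB unfolding cube_open_def by blast
      then have "cube (max n k) x \<subseteq> A \<inter> B"
        using cube_mono[OF xs, of n "max n k"] cube_mono[OF xs, of k "max n k"] by auto
      then show "\<exists>n. cube n x \<subseteq> A \<inter> B" ..
    qed (use AB in \<open>auto simp: cube_open_def\<close>)
  next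
    fix A assume "A \<in> all_cubes"
    then obtain n x where A: "x \<in> space N" "A = cube n x" by (auto simp: all_cubes_def)
    have "cube n y \<subseteq> space N - A" if "y \<in> space N - A" for y
      using that A cube_eq cube_self cube_space by (metis Diff_iff subsetI)
    moreover have "cube n y \<subseteq> A" if "y \<in> A" for y using that A cube_eq by blast
    ultimately show "A \<in> cube_open \<and> space N - A \<in> cube_open"
      using A cube_space unfolding cube_open_def by blast
  qed
  then obtain U V where UV: "U \<in> cube_open" "V \<in> cube_open" "B \<subseteq> U" "space N - B \<subseteq> V" "measure N (U \<inter> V) < e"
    by blast
  have sets: "U \<in> sets N" "V \<in> sets N" "B \<in> sets N"
    using UV cube_open_sets assms(1) sets.sigma_sets_subset[OF all_cubes_sets] by auto
  then have "measure N U \<le> measure N (B \<union> (U \<inter> V))"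
    using UV sets.sets_into_space[of U N] by (intro finite_measure_mono) auto
  also have "\<dots> \<le> measure N B + measure N (U \<inter> V)"
    using sets by (intro measure_Un_le) auto
  finally show ?thesis using that UV by auto
qed

text \<open>
  The maximal members of \<open>\<A>\<close>, by the first generation at which the descending cells around a point
  meet \<open>\<A>\<close>.  The same set may occur in several generations, hence the comparison by index.
\<close>

definition stopping_cubes :: "'a set set \<Rightarrow> 'a set set" where
  "stopping_cubes \<A> = {cube n x |n x. x \<in> space N \<and> cube n x \<in> \<A> \<and> (\<forall>k<n. cube k x \<notin> \<A>)}"

lemma stopping_cubesE:
  assumes "c \<in> stopping_cubes \<A>"
  obtains n x where "c = cube n x" "x \<in> space N" "c \<in> \<A>" "\<And>k. k < n \<Longrightarrow> cube k x \<notin> \<A>"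
  using assms unfolding stopping_cubes_def by blast

lemma stopping_cubes_subset: "stopping_cubes \<A> \<subseteq> all_cubes \<inter> \<A>"
  unfolding stopping_cubes_def all_cubes_def by auto

lemma countable_stopping_cubes: "countable (stopping_cubes \<A>)"
  using countable_all_cubes stopping_cubes_subset by (meson countable_subset le_inf_iff)

lemma stopping_cubes_sets: "stopping_cubes \<A> \<subseteq> sets N"
  using all_cubes_sets stopping_cubes_subset by blast

lemma Union_stopping_cubes: "\<Union>(stopping_cubes \<A>) = {x\<in>space N. \<exists>n. cube n x \<in> \<A>}"
proof (intro equalityI subsetI)
  fix x assume "x \<in> \<Union>(stopping_cubes \<A>)"
  then obtain n y where "y \<in> space N" "x \<in> cube n y" "cube n y \<in> \<A>"
    unfolding stopping_cubes_def by blast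
  then have "cube n x \<in> \<A>" "x \<in> space N" using cube_eq[of y x n] cube_space[of y x n] by simp_all
  then show "x \<in> {x\<in>space N. \<exists>n. cube n x \<in> \<A>}" by blast
next
  fix x assume "x \<in> {x\<in>space N. \<exists>n. cube n x \<in> \<A>}"
  then have x: "x \<in> space N" and ex: "\<exists>n. cube n x \<in> \<A>" by auto
  define n where "n = (LEAST n. cube n x \<in> \<A>)"
  have "cube n x \<in> \<A>" "\<forall>k<n. cube k x \<notin> \<A>"
    unfolding n_def using LeastI_ex[OF ex] not_less_Least by auto
  then have "cube n x \<in> stopping_cubes \<A>" unfolding stopping_cubes_def using x by blast
  then show "x \<in> \<Union>(stopping_cubes \<A>)" using cube_self[OF x] by blast
qed

text \<open>
  If two stopping cubes meet, the coarser one belongs to the chain of cells around every point of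
  the finer one, which therefore would have stopped there already.
\<close>

lemma disjoint_stopping_cubes: "disjoint (stopping_cubes \<A>)"
proof -
  have aux: "cube n x = cube k y"
    if "n \<le> k" "x \<in> space N" "y \<in> space N" "z \<in> cube n x" "z \<in> cube k y"
      "cube n x \<in> \<A>" "\<forall>j<k. cube j y \<notin> \<A>" for n k x y z
  proof -
    have "cube n x = cube n y" using that cube_eq cube_coarser by metis
    then have "n = k" using that by (metis order_le_less)
    then show ?thesis using \<open>cube n x = cube n y\<close> by simp
  qed
  show ?thesis
  proof (rule disjointI, rule ccontr)
    fix c d assume c: "c \<in> stopping_cubes \<A>" and d: "d \<in> stopping_cubes \<A>"
      and cd: "c \<noteq> d" and ne: "c \<inter> d \<noteq> {}"
    obtain n x where x: "c = cube n x" "x \<in> space N" "cube n x \<in> \<A>" "\<forall>j<n. cube j x \<notin> \<A>"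
      using c unfolding stopping_cubes_def by blast
    obtain k y where y: "d = cube k y" "y \<in> space N" "cube k y \<in> \<A>" "\<forall>j<k. cube j y \<notin> \<A>"
      using d unfolding stopping_cubes_def by blast
    obtain z where "z \<in> c" "z \<in> d" using ne by blast
    then show False
      using aux[of n k x y z] aux[of k n y x z] x y cd by (metis nle_le)
  qed
qed

section \<open>The dyadic maximal function\<close>

definition mean :: "('a \<Rightarrow> ennreal) \<Rightarrow> 'a set \<Rightarrow> ennreal" where
  "mean u c = (\<integral>\<^sup>+y\<in>c. u y \<partial>N) / emeasure N c"

definition dyadic_max :: "('a \<Rightarrow> ennreal) \<Rightarrow> 'a \<Rightarrow> ennreal" where
  "dyadic_max u x = (SUP n. mean u (cube n x))"

lemma nn_integral_cube_eq:
  assumes "c \<in> all_cubes"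
  shows "(\<integral>\<^sup>+y\<in>c. u y \<partial>N) = mean u c * emeasure N c"
proof -
  have "emeasure N c \<noteq> 0" using assms cube_pos by (auto simp: all_cubes_def)
  then show ?thesis
    unfolding mean_def by (simp add: ennreal_divide_times ennreal_divide_self less_top[symmetric])
qed

lemma dyadic_max_gt_eq:
  "{x\<in>space N. l < dyadic_max u x} = \<Union>(stopping_cubes {c. l < mean u c})"
  unfolding Union_stopping_cubes dyadic_max_def by (auto simp: less_SUP_iff)

lemma Union_stopping_cubes_sets: "\<Union>(stopping_cubes \<A>) \<in> sets N"
  by (intro sets.countable_Union countable_stopping_cubes stopping_cubes_sets)

lemma dyadic_max_measurable [measurable]: "dyadic_max u \<in> borel_measurable N"
  by (rule borel_measurableI_greater) (simp add: dyadic_max_gt_eq[of _ u] Union_stopping_cubes_sets)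

subsection \<open>Differentiation\<close>

text \<open>
  Cover \<open>E\<close> by stopping cubes inside an open set of almost the same measure, and keep those that
  meet \<open>E\<close>.  Each one contains a point where the maximal function is at most \<open>a\<close>, so it has mean at
  most \<open>a\<close>, and summation over the cubes gives the bound up to an error tending to zero.  The set \<open>B\<close> is a
  representative of \<open>E\<close> in the \<open>\<sigma>\<close>-algebra generated by the cells.
\<close>

lemma nn_integral_le_mult_on_low_set:
  assumes [measurable]: "u \<in> borel_measurable N" "E \<in> sets N"
    and E: "\<And>x. x \<in> E \<Longrightarrow> dyadic_max u x \<le> ennreal a" and a: "0 \<le> a"
    and B: "B \<in> sigma_sets (space N) all_cubes" "(E - B) \<union> (B - E) \<in> null_sets N"
  shows "(\<integral>\<^sup>+x\<in>E. u x \<partial>N) \<le> ennreal a * emeasure N E"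
proof -
  have B_sets [measurable]: "B \<in> sets N" using B(1) sets.sigma_sets_subset[OF all_cubes_sets] by auto
  have null: "E - B \<in> null_sets N" "B - E \<in> null_sets N"
    using B(2) null_sets_subset[of _ N] by auto
  have mB: "measure N B = measure N E"
    using null by (metis B_sets assms(2) emeasure_Un_null_set measure_def Un_Diff_cancel Un_commute)
  have le: "(\<integral>\<^sup>+x\<in>E. u x \<partial>N) \<le> ennreal (a * (measure N E + e))" if "0 < e" for e
  proof -
    obtain U where U: "U \<in> cube_open" "B \<subseteq> U" "measure N U < measure N B + e"
      using outer_approx_cube_open[OF B(1) \<open>0 < e\<close>] by blast
    have U_sets: "U \<in> sets N" using U cube_open_sets by auto
    define S where "S = {c\<in>stopping_cubes {c. c \<subseteq> U}. c \<inter> E \<noteq> {}}"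
    have S: "S \<subseteq> stopping_cubes {c. c \<subseteq> U}" by (auto simp: S_def)
    have US: "\<Union>S \<subseteq> U" using S stopping_cubes_subset[of "{c. c \<subseteq> U}"] by auto
    have cov: "E \<inter> B \<subseteq> \<Union>S"
    proof
      fix x assume x: "x \<in> E \<inter> B"
      then have "x \<in> {x\<in>space N. \<exists>n. cube n x \<in> {c. c \<subseteq> U}}"
        using U unfolding cube_open_def by auto
      then have "x \<in> \<Union>(stopping_cubes {c. c \<subseteq> U})" unfolding Union_stopping_cubes .
      then show "x \<in> \<Union>S" using x by (auto simp: S_def)
    qed
    have S_sets: "\<Union>S \<in> sets N"
      by (intro sets.countable_Union countable_subset[OF S countable_stopping_cubes]
           order_trans[OF S stopping_cubes_sets])
    have "(\<integral>\<^sup>+x\<in>E. u x \<partial>N) = (\<integral>\<^sup>+x\<in>E \<inter> B. u x \<partial>N)"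
    proof (rule nn_integral_cong_AE)
      show "AE x in N. u x * indicator E x = u x * indicator (E \<inter> B) x"
        using AE_not_in[OF null(1)] by eventually_elim (auto simp: indicator_def)
    qed
    also have "\<dots> \<le> (\<integral>\<^sup>+x\<in>\<Union>S. u x \<partial>N)"
      using cov by (intro nn_integral_mono) (auto simp: indicator_def)
    also have "\<dots> \<le> (\<integral>\<^sup>+x\<in>\<Union>S. ennreal a \<partial>N)"
    proof (rule nn_integral_disjoint_mono)
      show "disjoint S" using disjoint_stopping_cubes S by (rule pairwise_subset)
      show "countable S" using S countable_stopping_cubes by (rule countable_subset)
      show "S \<subseteq> sets N" using S stopping_cubes_sets by blast
      fix c assume "c \<in> S"
      then obtain x where c: "c \<in> all_cubes" "x \<in> c" "x \<in> E"
        using stopping_cubes_subset by (auto simp: S_def)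
      then obtain n y where "y \<in> space N" "c = cube n y" unfolding all_cubes_def by blast
      then have n: "c = cube n x" using cube_eq c by blast
      have "mean u c \<le> dyadic_max u x" unfolding n dyadic_max_def by (rule SUP_upper) simp
      also have "\<dots> \<le> ennreal a" using E c by blast
      finally have "mean u c * emeasure N c \<le> ennreal a * emeasure N c"
        by (rule mult_right_mono) simp
      moreover have "c \<in> sets N" using c(1) all_cubes_sets by blast
      ultimately show "(\<integral>\<^sup>+x\<in>c. u x \<partial>N) \<le> (\<integral>\<^sup>+x\<in>c. ennreal a \<partial>N)"
        using nn_integral_cube_eq[OF c(1), of u] by (simp add: nn_integral_cmult_indicator)
    qed auto
    also have "\<dots> = ennreal a * emeasure N (\<Union>S)" using S_sets by (simp add: nn_integral_cmult_indicator)
    also have "\<dots> \<le> ennreal a * emeasure N U" by (intro mult_left_mono emeasure_mono US U_sets) auto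
    also have "\<dots> \<le> ennreal (a * (measure N E + e))"
      using U(3) a by (auto simp: emeasure_eq_measure ennreal_mult[symmetric] mB intro!: ennreal_leI mult_left_mono)
    finally show ?thesis .
  qed
  have "(\<lambda>n. ennreal (a * (measure N E + inverse (real (Suc n))))) \<longlonglongrightarrow> ennreal (a * (measure N E + 0))"
    by (intro tendsto_intros LIMSEQ_inverse_real_of_nat)
  then have "(\<integral>\<^sup>+x\<in>E. u x \<partial>N) \<le> ennreal (a * (measure N E + 0))"
    by (rule LIMSEQ_le_const) (use le in auto)
  then show ?thesis using a by (simp add: ennreal_mult emeasure_eq_measure)
qed

text \<open>
  On \<open>{dyadic_max u \<le> a < u}\<close> the integral of \<open>u\<close> is at most \<open>a\<close> times the measure, although \<open>u\<close>
  exceeds \<open>a\<close> there; so this set is null for each of the countably many rational \<open>a\<close>.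
\<close>

lemma AE_le_dyadic_max:
  fixes u :: "'a \<Rightarrow> ennreal"
  assumes [measurable]: "u \<in> borel_measurable N"
    and B: "\<And>E. E \<in> sets N \<Longrightarrow> \<exists>B\<in>sigma_sets (space N) all_cubes. (E - B) \<union> (B - E) \<in> null_sets N"
  shows "AE x in N. u x \<le> dyadic_max u x"
proof -
  have "AE x in N. \<not> (dyadic_max u x \<le> ennreal a \<and> ennreal a < u x)" if a: "0 \<le> a" for a
  proof -
    define E where "E = {x\<in>space N. dyadic_max u x \<le> ennreal a \<and> ennreal a < u x}"
    have E [measurable]: "E \<in> sets N" unfolding E_def by measurable
    obtain B where "B \<in> sigma_sets (space N) all_cubes" "(E - B) \<union> (B - E) \<in> null_sets N"
      using B[OF E] by auto
    then have le: "(\<integral>\<^sup>+x\<in>E. u x \<partial>N) \<le> ennreal a * emeasure N E"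
      using E a by (intro nn_integral_le_mult_on_low_set) (auto simp: E_def)
    have "(\<integral>\<^sup>+x. ennreal a * indicator E x + (u x - ennreal a) * indicator E x \<partial>N) = (\<integral>\<^sup>+x\<in>E. u x \<partial>N)"
      by (intro nn_integral_cong) (auto simp: E_def indicator_def)
    then have "ennreal a * emeasure N E + (\<integral>\<^sup>+x. (u x - ennreal a) * indicator E x \<partial>N) \<le> ennreal a * emeasure N E + 0"
      using le by (subst (asm) nn_integral_add) (auto simp: nn_integral_cmult_indicator)
    then have "(\<integral>\<^sup>+x. (u x - ennreal a) * indicator E x \<partial>N) \<le> 0"
      by (subst (asm) ennreal_add_left_cancel_le) (auto simp: emeasure_eq_measure ennreal_mult_eq_top_iff)
    then have "AE x in N. (u x - ennreal a) * indicator E x = 0"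
      by (simp add: nn_integral_0_iff_AE)
    then show ?thesis using AE_space
      by eventually_elim (auto simp: E_def indicator_def diff_eq_0_iff_ennreal split: if_splits)
  qed
  then have "AE x in N. \<forall>a\<in>\<rat> \<inter> {0..}. \<not> (dyadic_max u x \<le> ennreal a \<and> ennreal a < u x)"
    by (subst AE_ball_countable) (auto intro: countable_subset[OF _ countable_rat])
  then show ?thesis
  proof eventually_elim
    case (elim x)
    show ?case
    proof (rule ccontr)
      assume "\<not> u x \<le> dyadic_max u x"
      then have "dyadic_max u x < u x" by simp
      then obtain q :: rat where q: "dyadic_max u x < ennreal (real_of_rat q)" "ennreal (real_of_rat q) < u x"
        using ennreal_rat_dense[of "dyadic_max u x" "u x"] by auto
      then have "0 < ennreal (real_of_rat q)" using zero_le le_less_trans by blast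
      then have "real_of_rat q \<in> \<rat> \<inter> {0..}" by (simp add: ennreal_less_zero_iff)
      then show False using elim q less_imp_le by blast
    qed
  qed
qed

subsection \<open>Level sets and higher integrability\<close>

text \<open>
  Because \<open>l\<close> is at least the global mean, a stopping cube is never the whole space, so it has a
  parent.  The parent did not stop, so its mean is at most \<open>l\<close>, and passing to the child costs the
  factor \<open>D\<close>.
\<close>

lemma nn_integral_upper_level_le:
  assumes [measurable]: "u \<in> borel_measurable N"
    and D: "\<And>n x. x \<in> space N \<Longrightarrow> emeasure N (cube n x) \<le> ennreal D * emeasure N (cube (Suc n) x)"
    and l: "mean u (space N) \<le> ennreal l" and nonneg: "0 \<le> D" "0 \<le> l"
  shows "(\<integral>\<^sup>+x\<in>{x\<in>space N. ennreal l < dyadic_max u x}. u x \<partial>N)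
    \<le> ennreal (D * l) * emeasure N {x\<in>space N. ennreal l < dyadic_max u x}"
proof -
  let ?S = "stopping_cubes {c. ennreal l < mean u c}"
  have "(\<integral>\<^sup>+x\<in>\<Union>?S. u x \<partial>N) \<le> (\<integral>\<^sup>+x\<in>\<Union>?S. ennreal (D * l) \<partial>N)"
  proof (rule nn_integral_disjoint_mono[OF countable_stopping_cubes stopping_cubes_sets disjoint_stopping_cubes])
    fix c assume c: "c \<in> ?S"
    then obtain n x where x: "c = cube n x" "x \<in> space N" and "c \<in> {c. ennreal l < mean u c}"
      and "\<And>k. k < n \<Longrightarrow> cube k x \<notin> {c. ennreal l < mean u c}"
      by (rule stopping_cubesE) (rule that)
    then have high: "ennreal l < mean u c" and low: "\<And>k. k < n \<Longrightarrow> mean u (cube k x) \<le> ennreal l"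
      by (simp_all only: mem_Collect_eq not_less)
    have "n \<noteq> 0"
    proof
      assume "n = 0"
      then have "c = space N" using x cube_0 by simp
      then show False using high l by simp
    qed
    then obtain k where k: "n = Suc k" using not0_implies_Suc by blast
    have cs: "c \<in> sets N" using c stopping_cubes_sets by blast
    have "(\<integral>\<^sup>+y\<in>c. u y \<partial>N) \<le> (\<integral>\<^sup>+y\<in>cube k x. u y \<partial>N)"
      using cube_Suc[OF x(2), of k] unfolding x(1) k
      by (intro nn_integral_mono) (auto simp: indicator_def)
    also have "\<dots> = mean u (cube k x) * emeasure N (cube k x)"
      using x(2) by (intro nn_integral_cube_eq) (auto simp: all_cubes_def)
    also have "\<dots> \<le> ennreal l * (ennreal D * emeasure N c)"
      using low[of k] D[OF x(2), of k] unfolding x(1) k by (intro mult_mono) auto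
    also have "\<dots> = ennreal (D * l) * emeasure N c"
      using nonneg by (simp add: ennreal_mult mult_ac)
    also have "\<dots> = (\<integral>\<^sup>+y\<in>c. ennreal (D * l) \<partial>N)"
      using cs by (simp add: nn_integral_cmult_indicator)
    finally show "(\<integral>\<^sup>+y\<in>c. u y \<partial>N) \<le> (\<integral>\<^sup>+y\<in>c. ennreal (D * l) \<partial>N)" .
  qed auto
  then show ?thesis
    unfolding dyadic_max_gt_eq using Union_stopping_cubes_sets by (simp add: nn_integral_cmult_indicator)
qed

text \<open>
  Localisation: above a stopping cube \<open>c\<close> all means are at most \<open>l\<close>, which is less than the mean
  over \<open>c\<close> itself.  Hence on \<open>c\<close> the supremum may be taken over cells inside \<open>c\<close>, and these do not see
  \<open>u\<close> outside \<open>c\<close>.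
\<close>

lemma nn_integral_dyadic_max_upper_level_le:
  assumes [measurable]: "u \<in> borel_measurable N"
    and A: "\<And>c. c \<in> all_cubes \<Longrightarrow>
      (\<integral>\<^sup>+x\<in>c. dyadic_max (\<lambda>y. u y * indicator c y) x \<partial>N) \<le> A * (\<integral>\<^sup>+x\<in>c. u x \<partial>N)"
  shows "(\<integral>\<^sup>+x\<in>{x\<in>space N. l < dyadic_max u x}. dyadic_max u x \<partial>N)
    \<le> A * (\<integral>\<^sup>+x\<in>{x\<in>space N. l < dyadic_max u x}. u x \<partial>N)"
proof -
  let ?S = "stopping_cubes {c. l < mean u c}"
  have "(\<integral>\<^sup>+x\<in>\<Union>?S. dyadic_max u x \<partial>N) \<le> (\<integral>\<^sup>+x\<in>\<Union>?S. A * u x \<partial>N)"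
  proof (rule nn_integral_disjoint_mono[OF countable_stopping_cubes stopping_cubes_sets disjoint_stopping_cubes])
    fix c assume c: "c \<in> ?S"
    then obtain n x where x: "c = cube n x" "x \<in> space N" and "c \<in> {c. l < mean u c}"
      and "\<And>k. k < n \<Longrightarrow> cube k x \<notin> {c. l < mean u c}"
      by (rule stopping_cubesE) (rule that)
    then have high: "l < mean u c" and low: "\<And>k. k < n \<Longrightarrow> mean u (cube k x) \<le> l"
      by (simp_all only: mem_Collect_eq not_less)
    have ca: "c \<in> all_cubes" using c stopping_cubes_subset by blast
    have [measurable]: "c \<in> sets N" using c stopping_cubes_sets by blast
    let ?v = "\<lambda>y. u y * indicator c y"
    have sub: "mean ?v d = mean u d" if "d \<subseteq> c" for d
      using that unfolding mean_def
      by (intro arg_cong2[where f = divide] nn_integral_cong refl) (auto simp: indicator_def)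
    have "dyadic_max u y \<le> dyadic_max ?v y" if y: "y \<in> c" for y
      unfolding dyadic_max_def
    proof (rule SUP_least)
      fix k
      have ys: "y \<in> space N" using cube_space x y by blast
      have cy: "cube n y = c" using cube_eq x y by blast
      show "mean u (cube k y) \<le> (SUP n. mean ?v (cube n y))"
      proof (cases "k < n")
        case True
        then have "cube k y = cube k x" using cube_coarser x y by simp
        then have "mean u (cube k y) \<le> l" using low[OF True] by simp
        also have "\<dots> \<le> mean ?v (cube n y)" using high sub[of c] cy by simp
        finally show ?thesis by (rule SUP_upper2[rotated]) simp
      next
        case False
        then have "cube k y \<subseteq> c" using cube_mono[OF ys, of n k] cy by simp
        then show ?thesis using sub by (intro SUP_upper2[of k]) auto
      qed
    qed
    then have "(\<integral>\<^sup>+y\<in>c. dyadic_max u y \<partial>N) \<le> (\<integral>\<^sup>+y\<in>c. dyadic_max ?v y \<partial>N)"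
      by (intro nn_integral_mono) (simp add: indicator_def)
    also have "\<dots> \<le> A * (\<integral>\<^sup>+x\<in>c. u x \<partial>N)" by (rule A[OF ca])
    also have "\<dots> = (\<integral>\<^sup>+x\<in>c. A * u x \<partial>N)" by (simp add: nn_integral_cmult mult.assoc)
    finally show "(\<integral>\<^sup>+y\<in>c. dyadic_max u y \<partial>N) \<le> (\<integral>\<^sup>+x\<in>c. A * u x \<partial>N)" .
  qed auto
  also have "\<dots> = A * (\<integral>\<^sup>+x\<in>\<Union>?S. u x \<partial>N)"
    using Union_stopping_cubes_sets by (simp add: nn_integral_cmult mult.assoc)
  finally show ?thesis unfolding dyadic_max_gt_eq .
qed

text \<open>
  The self-improvement.  The layer-cake inequality is used twice: with the maximal function itself,
  where the condition on \<open>r\<close> allows the last term to be absorbed into the left-hand side, and then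
  with \<open>u\<close>, where the first application bounds the last term.
\<close>

theorem nn_integral_powr_le_of_dyadic_max:
  fixes u :: "'a \<Rightarrow> ennreal" and A D r :: real
  assumes u [measurable]: "u \<in> borel_measurable N"
    and u_le: "AE x in N. u x \<le> dyadic_max u x"
    and W0: "(\<integral>\<^sup>+x. u x \<partial>N) \<noteq> 0" and Wtop: "(\<integral>\<^sup>+x. u x \<partial>N) \<noteq> \<infinity>"
    and D: "\<And>n x. x \<in> space N \<Longrightarrow> emeasure N (cube n x) \<le> ennreal D * emeasure N (cube (Suc n) x)"
    and A: "\<And>c. c \<in> all_cubes \<Longrightarrow>
      (\<integral>\<^sup>+x\<in>c. dyadic_max (\<lambda>y. u y * indicator c y) x \<partial>N) \<le> ennreal A * (\<integral>\<^sup>+x\<in>c. u x \<partial>N)"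
    and nonneg: "0 \<le> D" "0 \<le> A" and r: "0 < r" "2 * D * A * r \<le> 1 + r"
  shows "(\<integral>\<^sup>+x. u x * ennreal (enn2real (u x) powr r) \<partial>N)
    \<le> ennreal (2 * enn2real (mean u (space N)) powr r) * (\<integral>\<^sup>+x. u x \<partial>N)"
proof -
  define W where "W = (\<integral>\<^sup>+x. u x \<partial>N)"
  define s where "s = enn2real (mean u (space N))"
  let ?m = "dyadic_max u"
  define f where "f x = enn2real (?m x)" for x
  have [measurable]: "f \<in> borel_measurable N" unfolding f_def by measurable
  have "space N \<noteq> {}" using W0 nn_integral_empty by blast
  then have space_cube: "space N \<in> all_cubes" using cube_0 unfolding all_cubes_def by blast
  then have "emeasure N (space N) \<noteq> 0" using cube_pos by (auto simp: all_cubes_def)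
  moreover have mean_space: "mean u (space N) = W / emeasure N (space N)"
    unfolding mean_def W_def by (intro arg_cong2[where f = divide] nn_integral_cong refl) simp
  ultimately have "mean u (space N) \<noteq> top" "mean u (space N) \<noteq> 0"
    using W0 Wtop by (auto simp: W_def ennreal_divide_eq_top_iff ennreal_divide_eq_0_iff)
  then have mean_s: "mean u (space N) = ennreal s" and s: "0 < s"
    by (auto simp: s_def enn2real_positive_iff less_top[symmetric] zero_less_iff_neq_zero)

  have "dyadic_max (\<lambda>y. u y * indicator (space N) y) = ?m"
    unfolding dyadic_max_def mean_def
    by (intro ext SUP_cong refl arg_cong2[where f = divide] nn_integral_cong) simp
  then have "(\<integral>\<^sup>+x\<in>space N. ?m x \<partial>N) \<le> ennreal A * (\<integral>\<^sup>+x\<in>space N. u x \<partial>N)"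
    using A[OF space_cube] by simp
  also have "(\<integral>\<^sup>+x\<in>space N. ?m x \<partial>N) = (\<integral>\<^sup>+x. ?m x \<partial>N)" by (intro nn_integral_cong) simp
  also have "(\<integral>\<^sup>+x\<in>space N. u x \<partial>N) = W" unfolding W_def by (intro nn_integral_cong) simp
  finally have mW: "(\<integral>\<^sup>+x. ?m x \<partial>N) \<le> ennreal A * W" .
  have AWtop: "ennreal A * W < top" using Wtop by (simp add: W_def ennreal_mult_less_top less_top)
  then have "(\<integral>\<^sup>+x. ?m x \<partial>N) \<noteq> \<infinity>" using mW by auto
  then have "AE x in N. ?m x \<noteq> \<infinity>" by (intro nn_integral_noteq_infinite) auto
  then have mf: "AE x in N. ?m x = ennreal (f x)"
    by eventually_elim (simp add: f_def less_top)

  have level_u: "(\<integral>\<^sup>+x\<in>{x\<in>space N. l < f x}. u x \<partial>N) \<le> ennreal (D * l) * emeasure N {x\<in>space N. l < f x}"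
    and level_m: "(\<integral>\<^sup>+x\<in>{x\<in>space N. l < f x}. ?m x \<partial>N) \<le> ennreal (A * D * l) * emeasure N {x\<in>space N. l < f x}"
    if "s \<le> l" for l
  proof -
    let ?F = "{x\<in>space N. l < f x}" and ?G = "{x\<in>space N. ennreal l < ?m x}"
    have l: "0 \<le> l" using s that by simp
    have AE_FG: "AE x in N. x \<in> ?F \<longleftrightarrow> x \<in> ?G"
      using mf by eventually_elim (use l in \<open>simp add: ennreal_less_iff\<close>)
    have eq: "(\<integral>\<^sup>+x\<in>?F. h x \<partial>N) = (\<integral>\<^sup>+x\<in>?G. h x \<partial>N)" for h :: "'a \<Rightarrow> ennreal"
      using AE_FG by (intro nn_integral_cong_AE) (auto elim!: eventually_mono simp: indicator_def)
    have emeq: "emeasure N ?F = emeasure N ?G" using AE_FG by (intro emeasure_eq_AE) auto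
    have le: "mean u (space N) \<le> ennreal l" unfolding mean_s using that by (rule ennreal_leI)
    show u: "(\<integral>\<^sup>+x\<in>?F. u x \<partial>N) \<le> ennreal (D * l) * emeasure N ?F"
      unfolding eq emeq using nn_integral_upper_level_le[OF u D le nonneg(1) l] .
    have "(\<integral>\<^sup>+x\<in>?F. ?m x \<partial>N) \<le> ennreal A * (\<integral>\<^sup>+x\<in>?F. u x \<partial>N)"
      unfolding eq by (rule nn_integral_dyadic_max_upper_level_le[OF assms(1) A])
    also have "\<dots> \<le> ennreal A * (ennreal (D * l) * emeasure N ?F)" by (intro mult_left_mono u) simp
    also have "\<dots> = ennreal (A * D * l) * emeasure N ?F" using nonneg l by (simp add: ennreal_mult mult_ac)
    finally show "(\<integral>\<^sup>+x\<in>?F. ?m x \<partial>N) \<le> ennreal (A * D * l) * emeasure N ?F" .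
  qed

  obtain w where w: "W = ennreal w" "0 \<le> w" using Wtop by (cases W rule: ennreal_cases) (auto simp: W_def[symmetric])
  have f0: "0 \<le> f x" for x by (simp add: f_def)
  have trunc: "(\<integral>\<^sup>+x. u x * ennreal (min (f x) T powr r) \<partial>N) \<le> ennreal (2 * s powr r) * W"
    if T: "0 \<le> T" for T :: real
  proof -
    \<comment> \<open>\<open>?X\<close> is finite by truncation, which permits the absorption below.\<close>
    let ?X = "\<integral>\<^sup>+x. ?m x * ennreal (min (f x) T powr r) \<partial>N"
    let ?Y = "\<integral>\<^sup>+x. ennreal (min (f x) T powr (1 + r)) \<partial>N"
    have YX: "?Y \<le> ?X"
    proof (rule nn_integral_mono_AE, use mf in eventually_elim)
      case (elim x)
      have "min (f x) T powr (1 + r) = min (f x) T * min (f x) T powr r"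
        using f0[of x] T by (simp add: powr_mult_base)
      also have "\<dots> \<le> f x * min (f x) T powr r" by (intro mult_right_mono) auto
      finally show ?case unfolding elim using f0[of x] by (simp add: ennreal_mult[symmetric])
    qed
    have "?X \<le> (\<integral>\<^sup>+x. ennreal (T powr r) * ?m x \<partial>N)"
    proof (rule nn_integral_mono)
      fix x
      have "min (f x) T powr r \<le> T powr r" using f0[of x] T r by (intro powr_mono2) auto
      then show "?m x * ennreal (min (f x) T powr r) \<le> ennreal (T powr r) * ?m x"
        by (subst mult.commute) (intro mult_right_mono ennreal_leI, auto)
    qed
    also have "\<dots> \<le> ennreal (T powr r) * (ennreal A * W)"
      by (subst nn_integral_cmult) (auto intro!: mult_left_mono mW)
    also have "\<dots> < top" using AWtop by (simp add: ennreal_mult_less_top)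
    finally have "?X < top" .
    then obtain X where X: "?X = ennreal X" "0 \<le> X" by (cases ?X rule: ennreal_cases) auto
    have "?Y < top" using YX \<open>?X < top\<close> by (rule le_less_trans)
    then obtain Y where Y: "?Y = ennreal Y" "0 \<le> Y" by (cases ?Y rule: ennreal_cases) auto
    have "Y \<le> X" using YX X Y by simp
    have "?X \<le> ennreal (s powr r) * (\<integral>\<^sup>+x. ?m x \<partial>N) + ennreal (A * D * r / (1 + r)) * ?Y"
      by (rule nn_integral_truncated_powr_le)
        (use f0 s r nonneg T level_m sigma_finite_measure_axioms in \<open>auto simp: mult.assoc\<close>)
    also have "\<dots> \<le> ennreal (s powr r) * (ennreal A * W) + ennreal (A * D * r / (1 + r)) * ?Y"
      by (intro add_right_mono mult_left_mono mW) simp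
    finally have "X \<le> s powr r * (A * w) + A * D * r / (1 + r) * Y"
      unfolding X Y w using X(2) Y(2) w(2) nonneg r
      by (simp add: ennreal_mult[symmetric] ennreal_plus[symmetric] del: ennreal_plus)
    \<comment> \<open>This is where the size of \<open>r\<close> enters.\<close>
    also have "A * D * r / (1 + r) \<le> 1 / 2" using r by (simp add: field_simps)
    then have "A * D * r / (1 + r) * Y \<le> 1 / 2 * X"
      using \<open>Y \<le> X\<close> Y(2) by (intro mult_mono) auto
    finally have X_le: "X \<le> 2 * (s powr r * (A * w))" by simp
    have "(\<integral>\<^sup>+x. u x * ennreal (min (f x) T powr r) \<partial>N)
        \<le> ennreal (s powr r) * (\<integral>\<^sup>+x. u x \<partial>N) + ennreal (D * r / (1 + r)) * ?Y"
      by (rule nn_integral_truncated_powr_le)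
        (use f0 s r nonneg T level_u sigma_finite_measure_axioms in auto)
    also have "\<dots> = ennreal (s powr r * w + D * r / (1 + r) * Y)"
      unfolding W_def[symmetric] Y w using Y(2) w(2) nonneg r
      by (simp add: ennreal_mult[symmetric] ennreal_plus[symmetric] del: ennreal_plus)
    also have "\<dots> \<le> ennreal (2 * s powr r * w)"
    proof (rule ennreal_leI)
      have "D * r / (1 + r) * Y \<le> D * r / (1 + r) * (2 * (s powr r * (A * w)))"
        using \<open>Y \<le> X\<close> X_le nonneg r by (intro mult_left_mono) auto
      also have "\<dots> = (2 * D * A * r / (1 + r)) * (s powr r * w)" by simp
      also have "\<dots> \<le> 1 * (s powr r * w)" using r w(2) by (intro mult_right_mono) auto
      finally show "s powr r * w + D * r / (1 + r) * Y \<le> 2 * s powr r * w" by (simp add: mult_ac)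
    qed
    also have "\<dots> = ennreal (2 * s powr r) * W" using w by (simp add: ennreal_mult)
    finally show ?thesis .
  qed

  have "(\<integral>\<^sup>+x. u x * ennreal (enn2real (u x) powr r) \<partial>N)
      \<le> (\<integral>\<^sup>+x. (SUP n. u x * ennreal (min (f x) (real n) powr r)) \<partial>N)"
  proof (rule nn_integral_mono_AE, use u_le mf in eventually_elim)
    case (elim x)
    obtain n where n: "f x \<le> real n" using real_arch_simple by blast
    have "u x \<le> ennreal (f x)" using elim by simp
    then have "enn2real (u x) \<le> f x" using f0 enn2real_leI by blast
    then have "enn2real (u x) powr r \<le> min (f x) (real n) powr r"
      using n r by (intro powr_mono2) auto
    then have "u x * ennreal (enn2real (u x) powr r) \<le> u x * ennreal (min (f x) (real n) powr r)"
      by (intro mult_left_mono ennreal_leI) auto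
    then show ?case by (rule SUP_upper2[rotated]) simp
  qed
  also have "\<dots> = (SUP n. \<integral>\<^sup>+x. u x * ennreal (min (f x) (real n) powr r) \<partial>N)"
  proof (rule nn_integral_monotone_convergence_SUP)
    show "incseq (\<lambda>n x. u x * ennreal (min (f x) (real n) powr r))"
      using f0 r by (auto simp: incseq_def le_fun_def intro!: mult_left_mono ennreal_leI powr_mono2)
  qed simp
  also have "\<dots> \<le> ennreal (2 * s powr r) * W" by (intro SUP_least trunc) simp
  finally show ?thesis unfolding s_def W_def .
qed

end

section \<open>Dyadic cubes in a space of homogeneous type\<close>

context homogeneous_type_space
begin

text \<open>
  If a ball had infinite measure, the finiteness of \<open>D\<mu>\<close> times its measure would force \<open>D\<mu>\<close> to act
  as zero, and the doubled ball would be null.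
\<close>

lemma emeasure_qball:
  assumes "x \<in> space M" "0 < s"
  shows "0 < emeasure M (qball M \<rho> x s)" "emeasure M (qball M \<rho> x s) < \<infinity>"
proof -
  show pos: "0 < emeasure M (qball M \<rho> x s)" using qball_pos[of x "s / 2"] assms by simp
  show "emeasure M (qball M \<rho> x s) < \<infinity>"
  proof (rule ccontr)
    assume "\<not> emeasure M (qball M \<rho> x s) < \<infinity>"
    then have "emeasure M (qball M \<rho> x s) = top" by (simp add: less_top[symmetric])
    then have "ennreal D\<mu> = 0" using qball_finite[OF assms] by (simp add: ennreal_mult_less_top)
    then show False using doubling[OF assms] qball_pos[OF assms] by simp
  qed
qed

end

locale dyadic_system = homogeneous_type_space M \<rho> \<kappa> D\<mu>
  for M :: "'a measure" and \<rho> \<kappa> D\<mu> +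
  fixes \<delta> C0 \<epsilon> :: real and \<G> :: "int \<Rightarrow> 'a set set" and xc :: "int \<Rightarrow> 'a set \<Rightarrow> 'a"
  assumes dyadic: "dyadic_decomposition M \<rho> \<delta> C0 \<epsilon> \<G> xc"
begin

lemma constants: "1 < \<delta>" "0 < C0" "0 < \<epsilon>"
proof -
  note d = dyadic[unfolded dyadic_decomposition_def]
  show "1 < \<delta>" using d by (elim conjE) assumption
  show "0 < C0" using d by (elim conjE) assumption
  show "0 < \<epsilon>" using d by (elim conjE) assumption
qed

lemma gen_sets:
  "P \<in> \<G> k \<Longrightarrow> P \<in> sets M"
proof -
  have "\<forall>k. \<G> k \<subseteq> sets M"
    using dyadic unfolding dyadic_decomposition_def by (elim conjE) assumption
  then show "P \<in> \<G> k \<Longrightarrow> P \<in> sets M" by blast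
qed

lemma gen_cover:
  "x \<in> space M \<Longrightarrow> \<exists>P\<in>\<G> k. x \<in> P"
proof -
  have "\<forall>k. \<Union>(\<G> k) = space M"
    using dyadic unfolding dyadic_decomposition_def by (elim conjE) assumption
  then show "x \<in> space M \<Longrightarrow> \<exists>P\<in>\<G> k. x \<in> P" by blast
qed

lemma gen_nested:
  "P \<in> \<G> k \<Longrightarrow> Q \<in> \<G> l \<Longrightarrow> P \<inter> Q \<noteq> {} \<Longrightarrow> P \<subseteq> Q \<or> Q \<subseteq> P"
proof -
  have "\<forall>k l. \<forall>P\<in>\<G> k. \<forall>Q\<in>\<G> l. P \<inter> Q \<noteq> {} \<longrightarrow> P \<subseteq> Q \<or> Q \<subseteq> P"
    using dyadic unfolding dyadic_decomposition_def by (elim conjE) assumption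
  then show "P \<in> \<G> k \<Longrightarrow> Q \<in> \<G> l \<Longrightarrow> P \<inter> Q \<noteq> {} \<Longrightarrow> P \<subseteq> Q \<or> Q \<subseteq> P" by blast
qed

lemma gen_child:
  "Q \<in> \<G> k \<Longrightarrow> \<exists>R\<in>\<G> (k - 1). R \<subseteq> Q"
proof -
  have "\<forall>k. \<forall>Q\<in>\<G> k. \<exists>R\<in>\<G> (k - 1). R \<subseteq> Q"
    using dyadic unfolding dyadic_decomposition_def by (elim conjE) assumption
  then show "Q \<in> \<G> k \<Longrightarrow> \<exists>R\<in>\<G> (k - 1). R \<subseteq> Q" by blast
qed

lemma gen_parent:
  "Q \<in> \<G> k \<Longrightarrow> \<exists>!P. P \<in> \<G> (k + 1) \<and> Q \<subseteq> P"
proof -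
  have "\<forall>k. \<forall>Q\<in>\<G> k. \<exists>!P. P \<in> \<G> (k + 1) \<and> Q \<subseteq> P"
    using dyadic unfolding dyadic_decomposition_def by (elim conjE) assumption
  then show "Q \<in> \<G> k \<Longrightarrow> \<exists>!P. P \<in> \<G> (k + 1) \<and> Q \<subseteq> P" by blast
qed

lemma gen_child_measure:
  "P \<in> \<G> k \<Longrightarrow> R \<in> \<G> (k - 1) \<Longrightarrow> R \<subseteq> P \<Longrightarrow> ennreal \<epsilon> * emeasure M P \<le> emeasure M R"
proof -
  have "\<forall>k. \<forall>Q1\<in>\<G> k. \<forall>Q2\<in>\<G> (k - 1). Q2 \<subseteq> Q1 \<longrightarrow> ennreal \<epsilon> * emeasure M Q1 \<le> emeasure M Q2"
    using dyadic unfolding dyadic_decomposition_def by (elim conjE) assumption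
  then show "P \<in> \<G> k \<Longrightarrow> R \<in> \<G> (k - 1) \<Longrightarrow> R \<subseteq> P \<Longrightarrow> ennreal \<epsilon> * emeasure M P \<le> emeasure M R" by blast
qed

lemma gen_centre:
  assumes "Q \<in> \<G> k"
  shows "xc k Q \<in> space M" "qball M \<rho> (xc k Q) (\<delta> powi k) \<subseteq> Q" "Q \<subseteq> qball M \<rho> (xc k Q) (C0 * \<delta> powi k)"
proof -
  have "\<forall>k. \<forall>Q\<in>\<G> k. xc k Q \<in> space M \<and>
      qball M \<rho> (xc k Q) (\<delta> powi k) \<subseteq> Q \<and> Q \<subseteq> qball M \<rho> (xc k Q) (C0 * \<delta> powi k)"
    using dyadic unfolding dyadic_decomposition_def by (elim conjE) assumption
  from bspec[OF spec[OF this, of k] assms] show "xc k Q \<in> space M"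
    "qball M \<rho> (xc k Q) (\<delta> powi k) \<subseteq> Q" "Q \<subseteq> qball M \<rho> (xc k Q) (C0 * \<delta> powi k)"
    by simp_all
qed

lemma gen_emeasure:
  assumes "Q \<in> \<G> k"
  shows "0 < emeasure M Q" "emeasure M Q < \<infinity>"
proof -
  have d: "0 < \<delta> powi k" using constants by (simp add: zero_less_power_int)
  have "0 < emeasure M (qball M \<rho> (xc k Q) (\<delta> powi k))"
    using emeasure_qball gen_centre(1)[OF assms] d by blast
  also have "\<dots> \<le> emeasure M Q" using gen_centre(2)[OF assms] gen_sets[OF assms] by (rule emeasure_mono)
  finally show "0 < emeasure M Q" .
  have "emeasure M Q \<le> emeasure M (qball M \<rho> (xc k Q) (C0 * \<delta> powi k))"
    using gen_centre[OF assms] constants d by (intro emeasure_mono qball_measurable) auto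
  also have "\<dots> < \<infinity>" using emeasure_qball gen_centre(1)[OF assms] d constants by simp
  finally show "emeasure M Q < \<infinity>" .
qed

text \<open>
  Cubes that meet are nested; a child of the smaller one lies in both, and its parent is unique.
\<close>

lemma gen_eq:
  assumes P: "P \<in> \<G> k" and Q: "Q \<in> \<G> k" and "P \<inter> Q \<noteq> {}"
  shows "P = Q"
proof -
  have eq: "A = B" if AB: "A \<in> \<G> k" "B \<in> \<G> k" "A \<subseteq> B" for A B
  proof -
    obtain R where R: "R \<in> \<G> (k - 1)" "R \<subseteq> A" using gen_child[OF AB(1)] by blast
    have "A \<in> \<G> (k - 1 + 1)" "B \<in> \<G> (k - 1 + 1)" using AB by simp_all
    then show ?thesis using gen_parent[OF R(1)] R(2) AB(3) by blast
  qed
  show ?thesis using gen_nested[OF P Q assms(3)] eq[OF P Q] eq[OF Q P] by blast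
qed

definition gen_cube :: "int \<Rightarrow> 'a \<Rightarrow> 'a set" where
  "gen_cube k x = (THE P. P \<in> \<G> k \<and> x \<in> P)"

lemma gen_cube_eqI: "P \<in> \<G> k \<Longrightarrow> x \<in> P \<Longrightarrow> gen_cube k x = P"
  unfolding gen_cube_def by (rule the_equality) (use gen_eq in blast)+

lemma gen_cube:
  assumes "x \<in> space M"
  shows "gen_cube k x \<in> \<G> k" "x \<in> gen_cube k x"
proof -
  obtain P where "P \<in> \<G> k" "x \<in> P" using gen_cover assms by blast
  then show "gen_cube k x \<in> \<G> k" "x \<in> gen_cube k x" using gen_cube_eqI by auto
qed

lemma gen_cube_parent:
  assumes x: "x \<in> space M"
  shows "gen_cube k x \<subseteq> gen_cube (k + 1) x"
proof -
  obtain P where P: "P \<in> \<G> (k + 1)" "gen_cube k x \<subseteq> P" using gen_parent gen_cube(1)[OF x] by blast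
  then have "gen_cube (k + 1) x = P" using gen_cube(2)[OF x] by (intro gen_cube_eqI) auto
  then show ?thesis using P by simp
qed

text \<open>
  A cube of generation \<open>k - n\<close> containing \<open>x\<close> lies within distance \<open>2 \<bar>\<kappa>\<bar> C0 \<delta> powi (k - n)\<close> of \<open>x\<close>
  by the quasi-triangle inequality through its centre, and this tends to zero.  The absolute value
  avoids a discussion of the sign of \<open>\<kappa>\<close>.
\<close>

lemma qopen_contains_gen_cube:
  assumes U: "qopen M \<rho> U" and x: "x \<in> U"
  shows "\<exists>n. gen_cube (k - int n) x \<subseteq> U"
proof -
  obtain s where s: "0 < s" "qball M \<rho> x s \<subseteq> U" and xs: "x \<in> space M"
    using assms unfolding qopen_def by blast
  have d: "0 < \<delta>" using constants by simp
  define a where "a = 2 * \<bar>\<kappa>\<bar> * (C0 * \<delta> powi k)"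
  have "0 \<le> a" unfolding a_def using constants by simp
  obtain n where "a / s < \<delta> ^ n" using constants(1) real_arch_pow by blast
  then have n: "a / \<delta> ^ n < s" using s d by (simp add: field_simps)
  let ?P = "gen_cube (k - int n) x"
  let ?R = "C0 * \<delta> powi (k - int n)"
  have P: "?P \<in> \<G> (k - int n)" "x \<in> ?P" using gen_cube[OF xs] by auto
  have c: "xc (k - int n) ?P \<in> space M" using gen_centre(1)[OF P(1)] .
  have "?P \<subseteq> qball M \<rho> x s"
  proof
    fix y assume y: "y \<in> ?P"
    let ?c = "xc (k - int n) ?P"
    have ys: "y \<in> space M" using y gen_sets[OF P(1)] sets.sets_into_space by blast
    have *: "\<rho> ?c x < ?R" "\<rho> ?c y < ?R"
      using gen_centre(3)[OF P(1)] P(2) y unfolding qball_def by blast+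
    have "\<rho> x y \<le> \<kappa> * (\<rho> x ?c + \<rho> ?c y)" by (rule rho_quasi_triangle[OF xs c ys])
    also have "\<dots> \<le> \<bar>\<kappa>\<bar> * (?R + ?R)"
      using * rho_sym[OF xs c] rho_nonneg[OF xs c] rho_nonneg[OF c ys] by (intro mult_mono) auto
    also have "\<dots> = a / \<delta> ^ n"
      using d by (simp add: a_def power_int_diff)
    also have "\<dots> < s" by (rule n)
    finally show "y \<in> qball M \<rho> x s" using ys by (simp add: qball_def)
  qed
  then show ?thesis using s by blast
qed

end

locale dyadic_cube = dyadic_system +
  fixes k0 :: int and Q0 :: "'a set"
  assumes Q0: "Q0 \<in> \<G> k0"
begin

definition cube :: "nat \<Rightarrow> 'a \<Rightarrow> 'a set" where
  "cube n x = gen_cube (k0 - int n) x"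

lemma Q0_space: "x \<in> Q0 \<Longrightarrow> x \<in> space M"
  using gen_sets[OF Q0] sets.sets_into_space by blast

lemma Q0_Int_space [simp]: "Q0 \<inter> space M = Q0"
  using Q0_space by blast

abbreviation N :: "'a measure" where "N \<equiv> restrict_space M Q0"

lemma space_N: "space N = Q0"
  by (simp add: space_restrict_space)

lemma sets_N_iff: "A \<in> sets N \<longleftrightarrow> A \<subseteq> Q0 \<and> A \<in> sets M"
  using gen_sets[OF Q0] by (intro sets_restrict_space_iff) simp

lemma cube_gen: "x \<in> Q0 \<Longrightarrow> cube n x \<in> \<G> (k0 - int n)" "x \<in> Q0 \<Longrightarrow> x \<in> cube n x"
  using gen_cube Q0_space unfolding cube_def by blast+

lemma cube_Suc_subset: "x \<in> Q0 \<Longrightarrow> cube (Suc n) x \<subseteq> cube n x"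
  using gen_cube_parent[OF Q0_space, of x "k0 - int (Suc n)"] by (simp add: cube_def)

lemma cube_0_eq: "x \<in> Q0 \<Longrightarrow> cube 0 x = Q0"
  using Q0 by (simp add: cube_def gen_cube_eqI)

lemma cube_subset: "x \<in> Q0 \<Longrightarrow> cube n x \<subseteq> Q0"
  by (induction n) (use cube_0_eq cube_Suc_subset in blast)+

lemma emeasure_N: "A \<subseteq> Q0 \<Longrightarrow> emeasure N A = emeasure M A"
  using gen_sets[OF Q0] by (simp add: emeasure_restrict_space)

sublocale nested_partitions N cube
proof (intro nested_partitions.intro nested_partitions_axioms.intro)
  show "finite_measure N"
    using gen_emeasure(2)[OF Q0] by (intro finite_measureI) (simp add: space_N emeasure_N)
next
  fix n x assume x: "x \<in> space N"
  then have xQ: "x \<in> Q0" by (simp add: space_N)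
  show "cube n x \<in> sets N" using xQ cube_subset cube_gen gen_sets sets_N_iff by blast
  show "x \<in> cube n x" using cube_gen xQ by blast
  show "cube n y = cube n x" if "y \<in> cube n x" for y
    using that cube_gen(1)[OF xQ, of n] unfolding cube_def by (intro gen_cube_eqI)
  show "cube (Suc n) x \<subseteq> cube n x" using cube_Suc_subset xQ .
  show "cube 0 x = space N" using cube_0_eq xQ space_N by simp
  show "emeasure N (cube n x) \<noteq> 0"
    using gen_emeasure(1)[OF cube_gen(1)[OF xQ, of n]] cube_subset[OF xQ] by (simp add: emeasure_N)
qed

lemma all_cubes_gen: "c \<in> all_cubes \<Longrightarrow> \<exists>k. c \<in> \<G> k" "c \<in> all_cubes \<Longrightarrow> c \<subseteq> Q0"
  using cube_gen cube_subset unfolding all_cubes_def space_N by blast+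

lemma emeasure_cube_le:
  assumes "x \<in> space N"
  shows "emeasure N (cube n x) \<le> ennreal (1 / \<epsilon>) * emeasure N (cube (Suc n) x)"
proof -
  have x: "x \<in> Q0" using assms by (simp add: space_N)
  have "cube (Suc n) x \<in> \<G> (k0 - int n - 1)" using cube_gen(1)[OF x, of "Suc n"] by (simp add: algebra_simps)
  then have "ennreal \<epsilon> * emeasure N (cube n x) \<le> emeasure N (cube (Suc n) x)"
    using gen_child_measure cube_gen(1)[OF x] cube_Suc_subset[OF x] cube_subset[OF x] emeasure_N by metis
  then have "ennreal (1 / \<epsilon>) * (ennreal \<epsilon> * emeasure N (cube n x)) \<le> ennreal (1 / \<epsilon>) * emeasure N (cube (Suc n) x)"
    by (rule mult_left_mono) simp
  then show ?thesis using constants by (simp add: mult.assoc[symmetric] ennreal_mult[symmetric])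
qed

text \<open>
  Inside \<open>Q0\<close> an open set is a union of cubes, and there are only countably many cubes.
\<close>

lemma qborel_Int_sigma_cubes:
  assumes "B \<in> qborel_sets M \<rho>"
  shows "B \<inter> Q0 \<in> sigma_sets (space N) all_cubes"
  using assms unfolding qborel_sets_def
proof induction
  case (Basic U)
  have "U \<inter> Q0 \<in> cube_open"
    unfolding cube_open_def
  proof safe
    fix x assume x: "x \<in> U" "x \<in> Q0"
    then obtain n where "cube n x \<subseteq> U" using Basic qopen_contains_gen_cube unfolding cube_def by blast
    then show "\<exists>n. cube n x \<subseteq> U \<inter> Q0" using cube_subset[OF x(2)] by blast
  qed (simp add: space_N)
  then show ?case using cube_open_sigma_sets by blast
next
  case Empty
  then show ?case by (simp add: sigma_sets.Empty)
next
  case (Compl A)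
  have "(space M - A) \<inter> Q0 = space N - A \<inter> Q0" using Q0_space by (auto simp: space_N)
  then show ?case using sigma_sets.Compl[OF Compl.IH] by simp
next
  case (Union A)
  have "(\<Union>i. A i) \<inter> Q0 = (\<Union>i. A i \<inter> Q0)" by blast
  then show ?case using sigma_sets.Union[OF Union.IH] by simp
qed

lemma sets_up_to_null:
  assumes "E \<in> sets N"
  shows "\<exists>B\<in>sigma_sets (space N) all_cubes. (E - B) \<union> (B - E) \<in> null_sets N"
proof -
  have E: "E \<subseteq> Q0" "E \<in> sets M" using assms by (auto simp: sets_N_iff)
  obtain B where B: "B \<in> qborel_sets M \<rho>" "(E - B) \<union> (B - E) \<in> null_sets M"
    using qborel_up_to_null[OF E(2)] by blast
  have sets: "B \<in> sets M" using B qborel_measurable by blast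
  have "(E - B \<inter> Q0) \<union> (B \<inter> Q0 - E) \<in> null_sets M"
    by (rule null_sets_subset[OF B(2)]) (use E sets gen_sets[OF Q0] in auto)
  then have "(E - B \<inter> Q0) \<union> (B \<inter> Q0 - E) \<in> null_sets N"
    using E gen_sets[OF Q0] by (subst null_sets_restrict_space) auto
  then show ?thesis using qborel_Int_sigma_cubes[OF B(1)] by blast
qed

lemma set_nn_integral_N: "c \<subseteq> Q0 \<Longrightarrow> (\<integral>\<^sup>+x\<in>c. f x \<partial>N) = (\<integral>\<^sup>+x\<in>c. f x \<partial>M)"
  using gen_sets[OF Q0]
  by (subst nn_integral_restrict_space) (auto intro!: nn_integral_cong simp: indicator_def)

lemma dyadic_max_le_maximal_function:
  assumes "\<And>k. \<G> k \<subseteq> \<Q>" "x \<in> Q0"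
  shows "dyadic_max (\<lambda>y. ennreal (w y) * indicator c y) x
    \<le> maximal_function M \<Q> (\<lambda>y. w y * indicator c y) x"
  unfolding dyadic_max_def
proof (rule SUP_least)
  fix n
  let ?P = "cube n x"
  have P: "?P \<subseteq> Q0" using cube_subset assms(2) .
  have "mean (\<lambda>y. ennreal (w y) * indicator c y) ?P
      = (\<integral>\<^sup>+y\<in>?P. ennreal (w y) * indicator c y \<partial>M) / emeasure M ?P"
    unfolding mean_def set_nn_integral_N[OF P] emeasure_N[OF P] ..
  also have "\<dots> \<le> (\<integral>\<^sup>+y\<in>?P. ennreal \<bar>w y * indicator c y\<bar> \<partial>M) / emeasure M ?P"
    by (intro divide_right_mono_ennreal nn_integral_mono) (auto simp: indicator_def intro!: ennreal_leI)
  also have "\<dots> \<le> maximal_function M \<Q> (\<lambda>y. w y * indicator c y) x"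
    unfolding maximal_function_def
    using cube_gen[OF assms(2), of n] assms(1) by (intro SUP_upper) blast
  finally show "mean (\<lambda>y. ennreal (w y) * indicator c y) ?P
      \<le> maximal_function M \<Q> (\<lambda>y. w y * indicator c y) x" .
qed

text \<open>
  A cube lies in a ball, where \<open>w\<close> is integrable, and has positive measure, where \<open>w\<close> is positive
  almost everywhere.
\<close>

lemma weight_on_cube:
  assumes w: "weight M \<rho> w" and P: "P \<in> \<G> k"
  shows "set_integrable M P w" "(\<integral>\<^sup>+x\<in>P. ennreal (w x) \<partial>M) = ennreal (LINT x:P|M. w x)"
    "(\<integral>\<^sup>+x\<in>P. ennreal (w x) \<partial>M) \<noteq> 0"
proof -
  have [measurable]: "w \<in> borel_measurable M" and pos: "AE x in M. 0 < w x"
    using w unfolding weight_def by auto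
  have [measurable]: "P \<in> sets M" using gen_sets[OF P] .
  have "0 < C0 * \<delta> powi k" using constants by simp
  then have "set_integrable M (qball M \<rho> (xc k P) (C0 * \<delta> powi k)) w"
    using w gen_centre(1)[OF P] unfolding weight_def by blast
  then show int: "set_integrable M P w"
    by (rule set_integrable_subset) (use gen_centre(3)[OF P] in auto)
  have "(\<integral>\<^sup>+x\<in>P. ennreal (w x) \<partial>M) = (\<integral>\<^sup>+x. ennreal (indicator P x *\<^sub>R w x) \<partial>M)"
    by (intro nn_integral_cong) (auto simp: indicator_def)
  also have "\<dots> = ennreal (LINT x:P|M. w x)"
    unfolding set_lebesgue_integral_def
    by (rule nn_integral_eq_integral) (use int pos in \<open>auto simp: set_integrable_def indicator_def elim!: eventually_mono\<close>)
  finally show "(\<integral>\<^sup>+x\<in>P. ennreal (w x) \<partial>M) = ennreal (LINT x:P|M. w x)" .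
  show "(\<integral>\<^sup>+x\<in>P. ennreal (w x) \<partial>M) \<noteq> 0"
  proof
    assume "(\<integral>\<^sup>+x\<in>P. ennreal (w x) \<partial>M) = 0"
    then have "AE x in M. ennreal (w x) * indicator P x = 0" by (simp add: nn_integral_0_iff_AE)
    with pos have "AE x in M. x \<notin> P" by eventually_elim (auto simp: indicator_def split: if_splits)
    then have "emeasure M P = 0" by (simp add: AE_iff_null_sets null_setsD1)
    then show False using gen_emeasure(1)[OF P] by simp
  qed
qed

text \<open>
  Apply the self-improvement to the descendants of \<open>Q0\<close>.  Its hypothesis on the local maximal
  functions follows from the \<open>A\<^sub>\<infinity>\<close> condition, since \<open>\<Q>\<close> contains all cubes of the decomposition.
  Dividing by the measure turns \<open>s powr r * L\<close>, with \<open>s\<close> the mean and \<open>L\<close> the integral of \<open>w\<close>, into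
  \<open>s powr (1 + r)\<close>.
\<close>

lemma reverse_hoelder_on_cube:
  assumes w: "weight M \<rho> w"
    and \<Q>: "\<And>k. \<G> k \<subseteq> \<Q>" and fin: "A_infty_const M \<Q> w < \<infinity>"
    and r: "0 < r" "2 * (1 / \<epsilon>) * enn2real (A_infty_const M \<Q> w) * r \<le> 1 + r"
  shows "(\<integral>\<^sup>+x\<in>Q0. ennreal (w x powr (1 + r)) \<partial>M) / emeasure M Q0
    \<le> ennreal (2 * ((LINT x:Q0|M. w x) / measure M Q0) powr (1 + r))"
proof -
  define A where "A = enn2real (A_infty_const M \<Q> w)"
  define L where "L = (LINT x:Q0|M. w x)"
  define u where "u x = ennreal (w x)" for x
  have A: "A_infty_const M \<Q> w = ennreal A" "0 \<le> A" using fin by (auto simp: A_def)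
  have [measurable]: "w \<in> borel_measurable M" and pos: "AE x in M. 0 < w x"
    using w unfolding weight_def by auto
  have u [measurable]: "u \<in> borel_measurable M" unfolding u_def by measurable
  have uN: "u \<in> borel_measurable N" using u by (rule measurable_restrict_space1)
  have int_N: "(\<integral>\<^sup>+x. g x \<partial>N) = (\<integral>\<^sup>+x\<in>Q0. g x \<partial>M)" for g :: "'a \<Rightarrow> ennreal"
    using gen_sets[OF Q0] by (simp add: nn_integral_restrict_space)
  have L: "(\<integral>\<^sup>+x\<in>Q0. u x \<partial>M) = ennreal L" "ennreal L \<noteq> 0"
    using weight_on_cube[OF w Q0] by (auto simp: L_def u_def)
  from L(2) have L0: "0 < L" by (simp add: ennreal_eq_0_iff)

  have Ac: "(\<integral>\<^sup>+x\<in>c. dyadic_max (\<lambda>y. u y * indicator c y) x \<partial>N) \<le> ennreal A * (\<integral>\<^sup>+x\<in>c. u x \<partial>N)"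
    if c: "c \<in> all_cubes" for c
  proof -
    obtain k where k: "c \<in> \<G> k" using all_cubes_gen(1)[OF c] by blast
    have cQ: "c \<subseteq> Q0" using all_cubes_gen(2)[OF c] .
    let ?I = "\<integral>\<^sup>+x\<in>c. maximal_function M \<Q> (\<lambda>y. w y * indicator c y) x \<partial>M"
    let ?W = "\<integral>\<^sup>+x\<in>c. u x \<partial>M"
    have W: "?W \<noteq> 0" "?W \<noteq> top" using weight_on_cube[OF w k] by (auto simp: u_def)
    have "?I / ?W \<le> A_infty_const M \<Q> w"
      unfolding A_infty_const_def u_def using k \<Q> by (intro SUP_upper) blast
    then have "?I / ?W * ?W \<le> ennreal A * ?W" unfolding A by (rule mult_right_mono) simp
    then have "?I \<le> ennreal A * ?W"
      using W by (simp add: ennreal_divide_times ennreal_divide_self less_top[symmetric])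
    moreover have "(\<integral>\<^sup>+x\<in>c. dyadic_max (\<lambda>y. u y * indicator c y) x \<partial>M) \<le> ?I"
      using dyadic_max_le_maximal_function[OF \<Q>, of _ w c] cQ unfolding u_def
      by (intro nn_integral_mono) (auto simp: indicator_def)
    ultimately show ?thesis unfolding set_nn_integral_N[OF cQ] by simp
  qed

  define s where "s = enn2real (mean u (space N))"
  have "mean u (space N) = ennreal L / emeasure M Q0"
    unfolding mean_def space_N emeasure_N[OF order_refl] set_nn_integral_N[OF order_refl] L ..
  moreover have mQ: "emeasure M Q0 = ennreal (measure M Q0)" "0 < measure M Q0"
  proof -
    show "emeasure M Q0 = ennreal (measure M Q0)"
      using gen_emeasure(2)[OF Q0] by (intro emeasure_eq_ennreal_measure) simp
    show "0 < measure M Q0"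
      unfolding measure_def using gen_emeasure[OF Q0] by (subst enn2real_positive_iff) simp
  qed
  ultimately have s: "s = L / measure M Q0"
    using L0 by (simp add: s_def divide_ennreal)
  have "(\<integral>\<^sup>+x\<in>Q0. ennreal (w x powr (1 + r)) \<partial>M) \<le> (\<integral>\<^sup>+x. u x * ennreal (enn2real (u x) powr r) \<partial>N)"
    unfolding int_N
  proof (rule nn_integral_mono_AE, use pos in eventually_elim)
    case (elim x)
    then have "ennreal (w x powr (1 + r)) = u x * ennreal (enn2real (u x) powr r)"
      by (simp add: u_def powr_add ennreal_mult)
    then show ?case by simp
  qed
  also have "\<dots> \<le> ennreal (2 * s powr r) * (\<integral>\<^sup>+x. u x \<partial>N)"
    unfolding s_def
  proof (rule nn_integral_powr_le_of_dyadic_max[OF uN _ _ _ emeasure_cube_le Ac])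
    show "AE x in N. u x \<le> dyadic_max u x" by (rule AE_le_dyadic_max[OF uN sets_up_to_null])
  qed (use L constants A r in \<open>auto simp: int_N A_def\<close>)
  also have "\<dots> = ennreal (2 * s powr r * L)" unfolding int_N L using L0 by (simp add: ennreal_mult)
  finally have "(\<integral>\<^sup>+x\<in>Q0. ennreal (w x powr (1 + r)) \<partial>M) / emeasure M Q0
      \<le> ennreal (2 * s powr r * L) / emeasure M Q0"
    by (rule divide_right_mono_ennreal)
  also have "\<dots> = ennreal (2 * s powr r * s)" using L0 mQ by (simp add: divide_ennreal s)
  also have "2 * s powr r * s = 2 * s powr (1 + r)" using L0 mQ by (simp add: s powr_add)
  finally show ?thesis unfolding s L_def .
qed

end

theorem lemma4p8:
  fixes M :: "'a measure" and \<rho> :: "'a \<Rightarrow> 'a \<Rightarrow> real"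
    and \<kappa> D\<mu> \<delta> C0 \<epsilon> D r :: real
    and I :: "'i set" and \<D> :: "'i \<Rightarrow> int \<Rightarrow> 'a set set"
    and xc :: "'i \<Rightarrow> int \<Rightarrow> 'a set \<Rightarrow> 'a"
    and w :: "'a \<Rightarrow> real" and Q :: "'a set"
  assumes "homogeneous_type_space M \<rho> \<kappa> D\<mu>"
    and "finite I"
    and "\<And>i. i \<in> I \<Longrightarrow> dyadic_decomposition M \<rho> \<delta> C0 \<epsilon> (\<D> i) (xc i)"
    and "A_infty M \<rho> (cubes I \<D>) w"
    and "D = 1 / \<epsilon>"
    and "0 < r"
    and "r \<le> 1 / (2 * D * enn2real (A_infty_const M (cubes I \<D>) w) - 1)"
    and "Q \<in> cubes I \<D>"
  shows "(\<integral>\<^sup>+x\<in>Q. ennreal (w x powr (1 + r)) \<partial>M) / emeasure M Q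
           \<le> ennreal (2 * ((LINT x:Q|M. w x) / measure M Q) powr (1 + r))"
proof -
  obtain i k where i: "i \<in> I" and Q: "Q \<in> \<D> i k"
    using assms(8) unfolding cubes_def by blast
  interpret dyadic_cube M \<rho> \<kappa> D\<mu> \<delta> C0 \<epsilon> "\<D> i" "xc i" k Q
    using assms(1) assms(3)[OF i] Q
    by (intro dyadic_cube.intro dyadic_system.intro dyadic_system_axioms.intro dyadic_cube_axioms.intro)
  let ?A = "enn2real (A_infty_const M (cubes I \<D>) w)"
  have "0 < 1 / (2 * D * ?A - 1)" using assms(6,7) by (rule less_le_trans)
  then have "0 < 2 * D * ?A - 1" by simp
  then have "r * (2 * D * ?A - 1) \<le> 1" using assms(7) by (simp add: pos_le_divide_eq)
  then have "2 * (1 / \<epsilon>) * ?A * r \<le> 1 + r" unfolding assms(5) by (simp add: algebra_simps)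
  moreover have "\<D> i k \<subseteq> cubes I \<D>" for k using i unfolding cubes_def by blast
  ultimately show ?thesis
    using assms(4,6) unfolding A_infty_def by (intro reverse_hoelder_on_cube) auto
qed

end
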